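(* Let $m,n,k$ be positive integers with $2k \le m+n$, and let $K_{m,n}$ be the complete bipartite graph. Then \[ cpr_{2k}(K_{m,n}) \;\geq\; \binom{m}{2}\binom{n}{2}-\frac{(k^{4}-k^{2})\,m^{2}n^{2}}{12k^{4}}, \] and equality holds whenever $k \mid m$ and $k \mid n$.
   Context: A graph $G$ is $p$-partite if its vertex set can be partitioned into $p$ nonempty independent sets (parts). For a $p$-partite graph $G$ with a chosen partition into parts and a chosen numbering $1,\dots,p$ of the parts, a circular $p$-partite drawing of $G$ is obtained as follows: partition a circle into $p$ consecutive segments of arc; place the vertices of the $i$-th part at distinct points of the $i$-th segment of arc; draw each edge as the straight chord of the circle joining its endpoints, with no more than two edges meeting at any crossing point. A crossing is a point interior to the disk where two chords cross. The circular $p$-partite crossing number $cpr_{p}(G)$ is the minimum number of crossings taken over all circular $p$-partite drawings of $G$, over all possible partitions of the vertices of $G$ into $p$ parts (independent sets), and over all numberings of the parts. *)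

theory Defs
  imports "HOL-Analysis.Analysis"
begin

text \<open>A graph is given by a finite vertex set \<open>V\<close> and a set \<open>E\<close> of two-element subsets of \<open>V\<close>.\<close>

definition independent_set :: "'a set set \<Rightarrow> 'a set \<Rightarrow> bool" where
  "independent_set E S \<longleftrightarrow> (\<forall>u\<in>S. \<forall>v\<in>S. {u, v} \<notin> E)"

text \<open>The parts are indexed by \<open>0, \<dots>, p - 1\<close>; the function \<open>P\<close> carries both the partition and
  the numbering of its parts.\<close>

definition numbered_partition :: "nat \<Rightarrow> 'a set \<Rightarrow> 'a set set \<Rightarrow> (nat \<Rightarrow> 'a set) \<Rightarrow> bool" where
  "numbered_partition p V E P \<longleftrightarrow>
     (\<Union>i<p. P i) = V \<and> disjoint_family_on P {..<p} \<and>
     (\<forall>i<p. P i \<noteq> {} \<and> independent_set E (P i))"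

text \<open>The circle is the unit circle of the complex plane. It is cut into consecutive arcs at the
  angles \<open>\<theta> 0 < \<theta> 1 < \<dots> < \<theta> p = \<theta> 0 + 2 * pi\<close>. The arcs are half-open, so that they
  partition the circle.\<close>

definition arc_division :: "nat \<Rightarrow> (nat \<Rightarrow> real) \<Rightarrow> bool" where
  "arc_division p \<theta> \<longleftrightarrow> (\<forall>i<p. \<theta> i < \<theta> (Suc i)) \<and> \<theta> p = \<theta> 0 + 2 * pi"

definition arc_segment :: "(nat \<Rightarrow> real) \<Rightarrow> nat \<Rightarrow> complex set" where
  "arc_segment \<theta> i = cis ` {\<theta> i..<\<theta> (Suc i)}"

text \<open>For an edge \<open>{u, v}\<close> this is the closed segment from \<open>pos u\<close> to \<open>pos v\<close>.\<close>

definition chord :: "('a \<Rightarrow> complex) \<Rightarrow> 'a set \<Rightarrow> complex set" where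
  "chord pos e = convex hull (pos ` e)"

lemma chord_edge: "chord pos {u, v} = closed_segment (pos u) (pos v)"
  by (simp add: chord_def segment_convex_hull)

text \<open>Chords with a common endpoint meet only on the circle, and this is excluded by requiring the
  point to lie in the open disk. Two distinct chords that meet in the open disk cross there.\<close>

definition crossing_points :: "'a set set \<Rightarrow> ('a \<Rightarrow> complex) \<Rightarrow> complex set" where
  "crossing_points E pos =
     {x \<in> ball 0 1. \<exists>e\<in>E. \<exists>f\<in>E. e \<noteq> f \<and> x \<in> chord pos e \<inter> chord pos f}"

definition circular_drawing ::
  "nat \<Rightarrow> 'a set \<Rightarrow> 'a set set \<Rightarrow> (nat \<Rightarrow> 'a set) \<Rightarrow> (nat \<Rightarrow> real) \<Rightarrow> ('a \<Rightarrow> complex) \<Rightarrow> bool" where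
  "circular_drawing p V E P \<theta> pos \<longleftrightarrow>
     numbered_partition p V E P \<and> arc_division p \<theta> \<and>
     inj_on pos V \<and> (\<forall>i<p. pos ` P i \<subseteq> arc_segment \<theta> i) \<and>
     (\<forall>x\<in>crossing_points E pos. card {e \<in> E. x \<in> chord pos e} \<le> 2)"

text \<open>The infimum of a nonempty set of natural numbers is its minimum. If the graph is not
  \<open>p\<close>-partite, there is no drawing and the value is \<open>0\<close> by convention.\<close>

definition cpr :: "nat \<Rightarrow> 'a set \<Rightarrow> 'a set set \<Rightarrow> nat" where
  "cpr p V E = Inf {card (crossing_points E pos) |P \<theta> pos. circular_drawing p V E P \<theta> pos}"

definition K_verts :: "nat \<Rightarrow> nat \<Rightarrow> (nat + nat) set" where
  "K_verts m n = {..<m} <+> {..<n}"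

definition K_edges :: "nat \<Rightarrow> nat \<Rightarrow> (nat + nat) set set" where
  "K_edges m n = {{Inl i, Inr j} |i j. i < m \<and> j < n}"

end

theory Submission
  imports Defs
begin

text \<open>Two left and two right vertices span exactly one crossing of a circular drawing if the two
  kinds do not alternate around the circle, and none if they do, so the task is to maximise the
  number of alternating quadruples. If \<open>F b\<close> is the number of left vertices preceding the right
  vertex \<open>b\<close>, then this number is
  \<open>(\<Sum>b b'. \<bar>F b - F b'\<bar> * (m - \<bar>F b - F b'\<bar>)) / 2\<close>. Since \<open>F\<close> is constant on parts and at most
  \<open>k\<close> of the \<open>2 * k\<close> parts are right parts (otherwise exchange the two sides), \<open>F\<close> has at most
  \<open>k\<close> values. Completing the square bounds the sum by the squares of the centred ranks of the
  values of \<open>F\<close>, and their sum is \<open>(n\<^sup>3 - \<Sum>v. y v ^ 3) / 3\<close>, where \<open>y v\<close> is the number of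
  vertices with value \<open>v\<close>; convexity gives \<open>(\<Sum>v. y v ^ 3) \<ge> n\<^sup>3 / k\<^sup>2\<close>. Equality is attained by
  alternating parts of equal sizes.\<close>

section \<open>The quadratic form of the ranks\<close>

lemma sum_cubes_ge:
  fixes y :: "'a \<Rightarrow> real"
  assumes "finite S" "card S \<le> k" "k > 0" and nonneg: "\<And>v. v \<in> S \<Longrightarrow> 0 \<le> y v"
  shows "(\<Sum>v\<in>S. y v) ^ 3 / real k ^ 2 \<le> (\<Sum>v\<in>S. y v ^ 3)"
proof -
  \<comment> \<open>The value of \<open>y\<close> in the extremal case; the cube is bounded below by its tangent there.\<close>
  define q where "q = (\<Sum>v\<in>S. y v) / real k"
  have q0: "0 \<le> q" unfolding q_def using nonneg by (simp add: sum_nonneg)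
  have tangent: "3 * q ^ 2 * z - 2 * q ^ 3 \<le> z ^ 3" if "0 \<le> z" for z
  proof -
    have "0 \<le> (z - q) ^ 2 * (z + 2 * q)" using q0 that by simp
    then show ?thesis by (simp add: power2_eq_square power3_eq_cube algebra_simps)
  qed
  have "(\<Sum>v\<in>S. y v) ^ 3 / real k ^ 2 = 3 * q ^ 2 * (\<Sum>v\<in>S. y v) - 2 * q ^ 3 * real k"
    using \<open>k > 0\<close> by (simp add: q_def power2_eq_square power3_eq_cube field_simps)
  \<comment> \<open>Replacing \<open>k\<close> by the possibly smaller \<open>card S\<close> lowers
    the amount subtracted, since \<open>q\<close> is nonnegative.\<close>
  also have "\<dots> \<le> 3 * q ^ 2 * (\<Sum>v\<in>S. y v) - 2 * q ^ 3 * real (card S)"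
    using assms(2) q0 by (simp add: mult_left_mono)
  also have "\<dots> = (\<Sum>v\<in>S. 3 * q ^ 2 * y v - 2 * q ^ 3)"
    by (simp add: sum_subtractf sum_distrib_left)
  also have "\<dots> \<le> (\<Sum>v\<in>S. y v ^ 3)"
    by (intro sum_mono tangent nonneg)
  finally show ?thesis .
qed

text \<open>For fixed \<open>a\<close>, the pairs \<open>(b, c)\<close> in its fibre number the
  square of the fibre size; summing over \<open>a\<close> fibre by fibre supplies the third
  factor.\<close>

lemma sum_equal_triples:
  fixes F :: "'b \<Rightarrow> 'c"
  assumes "finite B"
  shows "(\<Sum>a\<in>B. \<Sum>b\<in>B. \<Sum>c\<in>B. of_bool (F a = F b \<and> F a = F c))
           = (\<Sum>v\<in>F ` B. real (card {b \<in> B. F b = v}) ^ 3)"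
proof -
  have "(\<Sum>b\<in>B. \<Sum>c\<in>B. of_bool (F a = F b \<and> F a = F c)) = real (card {b \<in> B. F b = F a}) ^ 2"
    for a
  proof -
    have "(\<Sum>b\<in>B. \<Sum>c\<in>B. of_bool (F a = F b \<and> F a = F c))
        = (\<Sum>b\<in>B. of_bool (F b = F a)) * (\<Sum>c\<in>B. of_bool (F c = F a) :: real)"
      by (auto simp: sum_product of_bool_conj intro!: sum.cong)
    then show ?thesis using assms by (simp add: power2_eq_square Int_def)
  qed
  then have "(\<Sum>a\<in>B. \<Sum>b\<in>B. \<Sum>c\<in>B. of_bool (F a = F b \<and> F a = F c))
      = (\<Sum>a\<in>B. real (card {b \<in> B. F b = F a}) ^ 2)" by simp
  also have "\<dots> = (\<Sum>v\<in>F ` B. \<Sum>a\<in>{a \<in> B. F a = v}. real (card {b \<in> B. F b = F a}) ^ 2)"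
    using assms by (rule sum.image_gen)
  also have "\<dots> = (\<Sum>v\<in>F ` B. \<Sum>a\<in>{a \<in> B. F a = v}. real (card {b \<in> B. F b = v}) ^ 2)"
    by (intro sum.cong) auto
  finally show ?thesis by (simp add: power2_eq_square power3_eq_cube mult.assoc)
qed

text \<open>The inner sum is the number of smaller values minus the number of larger ones, a centred
  rank up to a factor 2. Expanding its square gives triples, and letting each of the three points in
  turn be the distinguished one gives three copies of the same sum.\<close>

lemma sum_rank_squares:
  fixes F :: "'b \<Rightarrow> real"
  assumes "finite B"
  shows "3 * (\<Sum>a\<in>B. (\<Sum>b\<in>B. sgn (F a - F b)) ^ 2)
           = real (card B) ^ 3 - (\<Sum>v\<in>F ` B. real (card {b \<in> B. F b = v}) ^ 3)"
proof -
  let ?s = "\<lambda>a b. sgn (F a - F b)"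
  define R where "R = (\<Sum>a\<in>B. \<Sum>b\<in>B. \<Sum>c\<in>B. ?s a b * ?s a c)"
  have R1: "(\<Sum>a\<in>B. (\<Sum>b\<in>B. ?s a b) ^ 2) = R"
    by (simp add: R_def power2_eq_square sum_product)
  have R2: "R = (\<Sum>a\<in>B. \<Sum>b\<in>B. \<Sum>c\<in>B. ?s b a * ?s b c)"
    unfolding R_def by (rule sum.swap)
  have R3: "R = (\<Sum>a\<in>B. \<Sum>b\<in>B. \<Sum>c\<in>B. ?s c a * ?s c b)"
  proof -
    have "(\<Sum>a\<in>B. \<Sum>b\<in>B. \<Sum>c\<in>B. ?s c a * ?s c b) = (\<Sum>a\<in>B. \<Sum>c\<in>B. \<Sum>b\<in>B. ?s c a * ?s c b)"
      by (rule sum.cong[OF refl], rule sum.swap)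
    also have "\<dots> = R" unfolding R_def by (rule sum.swap)
    finally show ?thesis by simp
  qed
  \<comment> \<open>Among three values that are not all equal, the sign products cancel to \<open>1\<close>.\<close>
  have triple: "?s a b * ?s a c + ?s b a * ?s b c + ?s c a * ?s c b
      = 1 - of_bool (F a = F b \<and> F a = F c)" for a b c
    by (auto simp: sgn_if)
  have "3 * R = (\<Sum>a\<in>B. \<Sum>b\<in>B. \<Sum>c\<in>B. ?s a b * ?s a c + ?s b a * ?s b c + ?s c a * ?s c b)"
    unfolding sum.distrib using R2 R3 by (simp add: R_def)
  also have "\<dots> = real (card B) ^ 3
      - (\<Sum>a\<in>B. \<Sum>b\<in>B. \<Sum>c\<in>B. of_bool (F a = F b \<and> F a = F c))"
    unfolding triple by (simp add: sum_subtractf power3_eq_cube)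
  finally show ?thesis using R1 sum_equal_triples[OF assms, of F] by simp
qed

text \<open>For a fixed order of the values the sum is a quadratic polynomial in them; completing
  the square bounds it in terms of the ranks \<open>c\<close> alone. In the application
  \<open>M\<close> is the number of vertices on the other side and \<open>F\<close> counts those
  preceding a given vertex.\<close>

lemma pair_energy_bound:
  fixes F :: "'b \<Rightarrow> real" and M :: real
  assumes fin: "finite B" and k: "card (F ` B) \<le> k" "k > 0"
  shows "(\<Sum>a\<in>B. \<Sum>b\<in>B. \<bar>F a - F b\<bar> * (M - \<bar>F a - F b\<bar>))
           \<le> M ^ 2 * real (card B) ^ 2 * (1 - 1 / real k ^ 2) / 6"
proof (cases "B = {}")
  case False
  define n where "n = real (card B)"
  have n: "n > 0" using False fin by (simp add: n_def card_gt_0_iff)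
  define c where "c a = (\<Sum>b\<in>B. sgn (F a - F b))" for a
  define S where "S = (\<Sum>a\<in>B. F a)"
  define Q where "Q = (\<Sum>a\<in>B. F a ^ 2)"
  define C where "C = (\<Sum>a\<in>B. F a * c a)"
  \<comment> \<open>The sum splits into the variance of \<open>w\<close>, with a negative factor, and a multiple of \<open>\<Sum>a. (c a)\<^sup>2\<close>.\<close>
  define w where "w a = n * F a - M / 2 * c a" for a
  have sum_c: "(\<Sum>a\<in>B. c a) = 0"
  proof -
    have "(\<Sum>a\<in>B. c a) = (\<Sum>a\<in>B. \<Sum>b\<in>B. sgn (F b - F a))"
      unfolding c_def by (rule sum.swap)
    also have "\<dots> = (\<Sum>a\<in>B. \<Sum>b\<in>B. - sgn (F a - F b))"
      by (intro sum.cong refl) (metis minus_diff_eq sgn_minus)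
    also have "\<dots> = - (\<Sum>a\<in>B. c a)" by (simp add: c_def sum_negf)
    finally show ?thesis by simp
  qed
  \<comment> \<open>With signs in place of absolute values, each pair contributes once from either
    end, and the coefficient of \<open>F a\<close> becomes \<open>c a\<close>.\<close>
  have lin: "(\<Sum>a\<in>B. \<Sum>b\<in>B. \<bar>F a - F b\<bar>) = 2 * C"
  proof -
    have "(\<Sum>a\<in>B. \<Sum>b\<in>B. \<bar>F a - F b\<bar>)
        = (\<Sum>a\<in>B. \<Sum>b\<in>B. F a * sgn (F a - F b) + F b * sgn (F b - F a))"
      by (intro sum.cong refl) (auto simp: sgn_if)
    also have "\<dots> = C + (\<Sum>a\<in>B. \<Sum>b\<in>B. F b * sgn (F b - F a))"
      by (simp add: sum.distrib C_def c_def sum_distrib_left)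
    also have "(\<Sum>a\<in>B. \<Sum>b\<in>B. F b * sgn (F b - F a)) = C"
      unfolding C_def c_def sum_distrib_left by (rule sum.swap)
    finally show ?thesis by simp
  qed
  have quad: "(\<Sum>a\<in>B. \<Sum>b\<in>B. \<bar>F a - F b\<bar> ^ 2) = 2 * n * Q - 2 * S ^ 2"
  proof -
    have "(\<Sum>a\<in>B. \<Sum>b\<in>B. \<bar>F a - F b\<bar> ^ 2)
        = (\<Sum>a\<in>B. \<Sum>b\<in>B. F a ^ 2 + F b ^ 2 - 2 * (F a * F b))"
      by (intro sum.cong refl) (simp add: power2_eq_square algebra_simps)
    also have "\<dots> = 2 * n * Q - 2 * (\<Sum>a\<in>B. \<Sum>b\<in>B. F a * F b)"
      by (simp add: sum.distrib sum_subtractf n_def Q_def sum_distrib_left[symmetric])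
    also have "(\<Sum>a\<in>B. \<Sum>b\<in>B. F a * F b) = S ^ 2"
      by (simp add: S_def power2_eq_square sum_product)
    finally show ?thesis .
  qed
  have "(\<Sum>a\<in>B. \<Sum>b\<in>B. \<bar>F a - F b\<bar> * (M - \<bar>F a - F b\<bar>))
      = M * (\<Sum>a\<in>B. \<Sum>b\<in>B. \<bar>F a - F b\<bar>) - (\<Sum>a\<in>B. \<Sum>b\<in>B. \<bar>F a - F b\<bar> ^ 2)"
    by (simp add: sum_distrib_left sum_subtractf[symmetric] power2_eq_square algebra_simps)
  then have total: "(\<Sum>a\<in>B. \<Sum>b\<in>B. \<bar>F a - F b\<bar> * (M - \<bar>F a - F b\<bar>))
      = 2 * (M * C - n * Q + S ^ 2)" (is "?L = _")
    unfolding lin quad by (simp add: algebra_simps)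
  have sum_w: "(\<Sum>a\<in>B. w a) = n * S"
    unfolding w_def sum_subtractf sum_distrib_left[symmetric] sum_c S_def by simp
  have "(\<Sum>a\<in>B. w a ^ 2)
      = (\<Sum>a\<in>B. n ^ 2 * F a ^ 2 - n * M * (F a * c a) + M ^ 2 / 4 * c a ^ 2)"
    by (intro sum.cong refl) (simp add: w_def power2_eq_square field_simps)
  also have "\<dots> = n ^ 2 * Q - n * M * C + M ^ 2 / 4 * (\<Sum>a\<in>B. c a ^ 2)"
    by (simp only: sum.distrib sum_subtractf sum_distrib_left[symmetric] Q_def C_def)
  finally have sum_w2: "(\<Sum>a\<in>B. w a ^ 2) = n ^ 2 * Q - n * M * C + M ^ 2 / 4 * (\<Sum>a\<in>B. c a ^ 2)" .
  \<comment> \<open>The variance of \<open>w\<close> is nonnegative; it vanishes when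
    \<open>F\<close> is \<open>M / (2 * n) * c\<close> up to a constant.\<close>
  have "(\<Sum>a\<in>B. w a) ^ 2 \<le> n * (\<Sum>a\<in>B. w a ^ 2)"
    using Cauchy_Schwarz_ineq_sum[of w "\<lambda>_. 1" B] by (simp add: n_def mult.commute)
  then have "n * (n * S ^ 2) \<le> n * (\<Sum>a\<in>B. w a ^ 2)"
    by (simp add: sum_w power2_eq_square mult_ac)
  then have "n * S ^ 2 \<le> (\<Sum>a\<in>B. w a ^ 2)" using n by simp
  then have "n * ?L \<le> M ^ 2 / 2 * (\<Sum>a\<in>B. c a ^ 2)"
    unfolding total sum_w2 by (simp add: power2_eq_square algebra_simps)
  also have "(\<Sum>a\<in>B. c a ^ 2) = (n ^ 3 - (\<Sum>v\<in>F ` B. real (card {b \<in> B. F b = v}) ^ 3)) / 3"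
    using sum_rank_squares[OF fin, of F] by (simp add: c_def n_def)
  also have "M ^ 2 / 2 * \<dots> \<le> M ^ 2 / 2 * ((n ^ 3 - n ^ 3 / real k ^ 2) / 3)"
  proof -
    have "n = (\<Sum>v\<in>F ` B. real (card {b \<in> B. F b = v}))"
      using sum.image_gen[OF fin, of "\<lambda>_. 1 :: real" F] by (simp add: n_def)
    then have "n ^ 3 / real k ^ 2 \<le> (\<Sum>v\<in>F ` B. real (card {b \<in> B. F b = v}) ^ 3)"
      using sum_cubes_ge[of "F ` B" k "\<lambda>v. real (card {b \<in> B. F b = v})"] fin k by simp
    then show ?thesis by (intro mult_left_mono divide_right_mono) auto
  qed
  also have "\<dots> = n * (M ^ 2 * n ^ 2 * (1 - 1 / real k ^ 2) / 6)"
    by (simp add: power2_eq_square power3_eq_cube algebra_simps diff_divide_distrib)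
  finally show ?thesis using n by (simp add: n_def)
qed simp

section \<open>Chords of the unit circle\<close>

lemma sgn_sin_half:
  assumes "\<bar>x\<bar> < 2 * pi"
  shows "sgn (sin (x / 2)) = sgn x"
proof (cases x "0 :: real" rule: linorder_cases)
  case less
  have "0 < sin (- x / 2)" using less assms by (intro sin_gt_zero) (auto simp: abs_if)
  then have "sin (x / 2) < 0" by simp
  then show ?thesis using less by simp
next
  case greater
  have "0 < sin (x / 2)" using greater assms by (intro sin_gt_zero) auto
  then show ?thesis using greater by simp
qed simp

text \<open>The line through \<open>cis s\<close> and \<open>cis t\<close> is the zero set of the following affine form.\<close>

definition line_form :: "real \<Rightarrow> real \<Rightarrow> complex \<Rightarrow> real" where
  "line_form s t x = Re (x * cis (- ((s + t) / 2))) - cos ((t - s) / 2)"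

lemma line_form_affine:
  "line_form s t ((1 - l) *\<^sub>R x + l *\<^sub>R y) = (1 - l) * line_form s t x + l * line_form s t y"
  by (simp add: line_form_def algebra_simps)

lemma line_form_cis: "line_form s t (cis u) = 2 * sin ((u - s) / 2) * sin ((t - u) / 2)"
proof -
  have "line_form s t (cis u) = cos (u - (s + t) / 2) - cos ((t - s) / 2)"
    by (simp add: line_form_def cis_mult)
  also have "\<dots> = 2 * sin ((u - s) / 2) * sin ((t - u) / 2)"
    unfolding cos_diff_cos
    by (rule arg_cong2[of _ _ _ _ "\<lambda>a b. 2 * sin a * sin b"]) (simp_all add: field_simps)
  finally show ?thesis .
qed

text \<open>In the window both half differences lie strictly between \<open>- pi\<close> and
  \<open>pi\<close>, where sine has the sign of its argument. So the side of the chord on which a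
  point of the circle lies can be read off the order of the angles.\<close>

lemma sgn_line_form_cis:
  assumes "{s, t, u} \<subseteq> {w..<w + 2 * pi}"
  shows "sgn (line_form s t (cis u)) = sgn (u - s) * sgn (t - u)"
proof -
  have "\<bar>u - s\<bar> < 2 * pi" "\<bar>t - u\<bar> < 2 * pi" using assms by auto
  from this[THEN sgn_sin_half] show ?thesis by (simp add: line_form_cis sgn_mult)
qed

text \<open>Rotating by the mean angle makes the chord vertical with real part \<open>cos d\<close>.
  On that line the disk condition bounds the imaginary part in absolute value by
  \<open>\<bar>sin d\<bar>\<close>, which is its size at the endpoints.\<close>

lemma closed_segment_cis_iff:
  assumes "s \<noteq> t" "\<bar>t - s\<bar> < 2 * pi"
  shows "x \<in> closed_segment (cis s) (cis t) \<longleftrightarrow> line_form s t x = 0 \<and> norm x \<le> 1"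
proof
  assume x: "x \<in> closed_segment (cis s) (cis t)"
  then obtain l where l: "x = (1 - l) *\<^sub>R cis s + l *\<^sub>R cis t" by (auto simp: in_segment)
  have "closed_segment (cis s) (cis t) \<subseteq> cball 0 1"
    by (intro closed_segment_subset) auto
  then have "norm x \<le> 1" using x by auto
  moreover have "line_form s t x = 0"
    unfolding l line_form_affine by (simp add: line_form_cis)
  ultimately show "line_form s t x = 0 \<and> norm x \<le> 1" by simp
next
  assume A: "line_form s t x = 0 \<and> norm x \<le> 1"
  define d where "d = (t - s) / 2"
  define z where "z = x * cis (- ((s + t) / 2))"
  have sin_d: "sin d \<noteq> 0"
    using sgn_sin_half[OF assms(2)] assms(1) by (auto simp: d_def sgn_0_0)
  have Re_z: "Re z = cos d" using A by (simp add: line_form_def z_def d_def)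
  have "norm z \<le> 1" using A by (simp add: z_def norm_mult)
  then have "(Re z) ^ 2 + (Im z) ^ 2 \<le> 1" by (simp add: cmod_def)
  then have "(Im z) ^ 2 \<le> (sin d) ^ 2" by (simp add: Re_z sin_squared_eq)
  then have "\<bar>Im z\<bar> \<le> \<bar>sin d\<bar>" by (simp add: abs_le_square_iff)
  \<comment> \<open>The height relative to the half chord; \<open>l\<close> rescales it from the
    range -1 to 1 to the range 0 to 1.\<close>
  define r where "r = Im z / sin d"
  have "\<bar>r\<bar> \<le> 1" using sin_d \<open>\<bar>Im z\<bar> \<le> \<bar>sin d\<bar>\<close> by (simp add: r_def divide_le_eq)
  define l where "l = (r + 1) / 2"
  have l: "0 \<le> l" "l \<le> 1" using \<open>\<bar>r\<bar> \<le> 1\<close> by (auto simp: l_def)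
  have z: "z = (1 - l) *\<^sub>R cis (- d) + l *\<^sub>R cis d"
    using sin_d by (intro complex_eqI) (simp_all add: Re_z l_def r_def field_simps)
  have "x = z * cis ((s + t) / 2)" by (simp add: z_def mult.assoc cis_mult)
  also have "\<dots> = (1 - l) *\<^sub>R cis (- d + (s + t) / 2) + l *\<^sub>R cis (d + (s + t) / 2)"
    unfolding z by (simp add: algebra_simps cis_mult)
  also have "- d + (s + t) / 2 = s" by (simp add: d_def field_simps)
  also have "d + (s + t) / 2 = t" by (simp add: d_def field_simps)
  finally show "x \<in> closed_segment (cis s) (cis t)" using l by (auto simp: in_segment)
qed

text \<open>The degenerate form \<open>line_form s s\<close> describes the tangent at
  \<open>cis s\<close>, which within the window is met only at the angle \<open>s\<close>.\<close>

lemma cis_inj_on_window: "inj_on cis {w..<w + 2 * pi}"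
proof (rule inj_onI)
  fix s t assume st: "s \<in> {w..<w + 2 * pi}" "t \<in> {w..<w + 2 * pi}" "cis s = cis t"
  have "line_form s s (cis t) = 0"
    using st(3)[symmetric] by (simp add: line_form_cis)
  then have "sgn (t - s) * sgn (s - t) = 0"
    using sgn_line_form_cis[of s s t w] st by simp
  then show "s = t" by (auto simp: sgn_0_0)
qed

text \<open>The condition \<open>(s < u) \<noteq> (t < u)\<close> says that \<open>u\<close> lies
  between \<open>s\<close> and \<open>t\<close>. Exactly one of \<open>u\<close> and
  \<open>v\<close> doing so is the order-theoretic form of two chords crossing; the clauses on
  equality make the predicate fail for chords with a common endpoint.\<close>

definition separated :: "real \<Rightarrow> real \<Rightarrow> real \<Rightarrow> real \<Rightarrow> bool" where
  "separated s t u v \<longleftrightarrow> s \<notin> {u, v} \<and> t \<notin> {u, v} \<and> ((s < u) \<noteq> (t < u)) \<noteq> ((s < v) \<noteq> (t < v))"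

lemma separated_iff_sgn:
  "separated s t u v \<longleftrightarrow> sgn (u - s) * sgn (t - u) * (sgn (v - s) * sgn (t - v)) < 0"
  by (auto simp: separated_def sgn_if)

text \<open>Distinct chords do not have the same two ends, so the affine form of the first line does
  not vanish at both ends of the second chord, and hence vanishes at most once along it.\<close>

lemma chords_meet_once:
  assumes win: "{s, t, u, v} \<subseteq> {w..<w + 2 * pi}" and ne: "s \<noteq> t" "u \<noteq> v" "{s, t} \<noteq> {u, v}"
    and x: "x \<in> closed_segment (cis s) (cis t)" "x \<in> closed_segment (cis u) (cis v)"
    and y: "y \<in> closed_segment (cis s) (cis t)" "y \<in> closed_segment (cis u) (cis v)"
  shows "x = y"
proof -
  have "\<bar>t - s\<bar> < 2 * pi" using win by auto
  then have 0: "line_form s t x = 0" "line_form s t y = 0"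
    using x y ne closed_segment_cis_iff by auto
  define \<alpha> \<beta> where "\<alpha> = line_form s t (cis u)" and "\<beta> = line_form s t (cis v)"
  have "sgn \<alpha> = sgn (u - s) * sgn (t - u)" "sgn \<beta> = sgn (v - s) * sgn (t - v)"
    unfolding \<alpha>_def \<beta>_def using win by (auto intro!: sgn_line_form_cis)
  then have nz: "\<alpha> \<noteq> 0 \<or> \<beta> \<noteq> 0" using ne by (auto simp: sgn_0_0)
  obtain l where l: "x = (1 - l) *\<^sub>R cis u + l *\<^sub>R cis v" using x by (auto simp: in_segment)
  obtain k where k: "y = (1 - k) *\<^sub>R cis u + k *\<^sub>R cis v" using y by (auto simp: in_segment)
  have l0: "(1 - l) * \<alpha> + l * \<beta> = 0" and k0: "(1 - k) * \<alpha> + k * \<beta> = 0"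
    using 0 unfolding l k line_form_affine \<alpha>_def \<beta>_def by auto
  have "(l - k) * (\<beta> - \<alpha>) = 0" using l0 k0 by (simp add: algebra_simps)
  moreover have "\<beta> \<noteq> \<alpha>" using l0 nz by (auto simp: algebra_simps)
  ultimately show ?thesis by (simp add: l k)
qed

text \<open>The affine form of the first line has a zero strictly inside the second chord iff its
  signs at the two ends are opposite, which by \<open>sgn_line_form_cis\<close> is
  \<open>separated\<close>. It cannot vanish at both ends because the chords differ.\<close>

lemma chords_meet_iff:
  assumes win: "{s, t, u, v} \<subseteq> {w..<w + 2 * pi}" and ne: "s \<noteq> t" "u \<noteq> v" "{s, t} \<noteq> {u, v}"
  shows "(\<exists>x\<in>ball 0 1. x \<in> closed_segment (cis s) (cis t) \<inter> closed_segment (cis u) (cis v))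
           \<longleftrightarrow> separated s t u v"
proof -
  have st: "\<bar>t - s\<bar> < 2 * pi" using win by auto
  define \<alpha> \<beta> where "\<alpha> = line_form s t (cis u)" and "\<beta> = line_form s t (cis v)"
  have sgn: "sgn \<alpha> = sgn (u - s) * sgn (t - u)" "sgn \<beta> = sgn (v - s) * sgn (t - v)"
    unfolding \<alpha>_def \<beta>_def using win by (auto intro!: sgn_line_form_cis)
  have nz: "\<alpha> \<noteq> 0 \<or> \<beta> \<noteq> 0" using ne sgn by (auto simp: sgn_0_0)
  have sep: "separated s t u v \<longleftrightarrow> \<alpha> * \<beta> < 0"
    unfolding separated_iff_sgn sgn[symmetric] by (simp add: sgn_mult[symmetric])
  show ?thesis
  proof
    assume "\<exists>x\<in>ball 0 1. x \<in> closed_segment (cis s) (cis t) \<inter> closed_segment (cis u) (cis v)"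
    then obtain x where x: "norm x < 1" "x \<in> closed_segment (cis s) (cis t)"
      "x \<in> closed_segment (cis u) (cis v)" by auto
    obtain l where l: "x = (1 - l) *\<^sub>R cis u + l *\<^sub>R cis v" "0 \<le> l" "l \<le> 1"
      using x by (auto simp: in_segment)
    have "l \<noteq> 0" "l \<noteq> 1" using l x(1) by auto
    then have l01: "0 < l" "l < 1" using l by auto
    have "line_form s t x = 0" using x(2) closed_segment_cis_iff[OF ne(1) st] by auto
    then have eq: "(1 - l) * \<alpha> + l * \<beta> = 0" unfolding l line_form_affine \<alpha>_def \<beta>_def .
    have "\<alpha> \<noteq> 0" using eq l01 nz by auto
    have "l * (\<alpha> * \<beta>) = \<alpha> * (l * \<beta>)" by simp
    also have "l * \<beta> = - ((1 - l) * \<alpha>)" using eq by simp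
    also have "\<alpha> * - ((1 - l) * \<alpha>) < 0"
      using l01 \<open>\<alpha> \<noteq> 0\<close> by (auto simp: mult_less_0_iff zero_less_mult_iff)
    finally show "separated s t u v" using l01 by (simp add: sep mult_less_0_iff)
  next
    assume "separated s t u v"
    then have neg: "\<alpha> * \<beta> < 0" by (simp add: sep)
    define l where "l = \<alpha> / (\<alpha> - \<beta>)"
    have "\<alpha> < 0 \<and> 0 < \<beta> \<or> \<beta> < 0 \<and> 0 < \<alpha>" using neg by (auto simp: mult_less_0_iff)
    then have l: "0 < l" "l < 1" and "\<alpha> - \<beta> \<noteq> 0"
      unfolding l_def by (auto simp: divide_less_eq zero_less_divide_iff)
    have "(1 - l) * \<alpha> + l * \<beta> = \<alpha> - l * (\<alpha> - \<beta>)" by (simp add: algebra_simps)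
    then have l0: "(1 - l) * \<alpha> + l * \<beta> = 0" using \<open>\<alpha> - \<beta> \<noteq> 0\<close> by (simp add: l_def)
    define x where "x = (1 - l) *\<^sub>R cis u + l *\<^sub>R cis v"
    have "cis u \<noteq> cis v" using cis_inj_on_window[of w] win ne(2) by (auto dest: inj_onD)
    then have os: "x \<in> open_segment (cis u) (cis v)"
      unfolding in_segment x_def using l by blast
    \<comment> \<open>Strict convexity of the disk: a point strictly between two points of the
      circle is nearer to the centre.\<close>
    then have "norm x < 1"
      using dist_decreases_open_segment[OF os, of 0] by auto
    moreover have "x \<in> closed_segment (cis u) (cis v)"
      using os by (simp add: open_segment_def)
    moreover have "line_form s t x = 0"
      using l0 unfolding x_def line_form_affine \<alpha>_def \<beta>_def .
    ultimately show "\<exists>x\<in>ball 0 1. x \<in> closed_segment (cis s) (cis t) \<inter> closed_segment (cis u) (cis v)"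
      using closed_segment_cis_iff[OF ne(1) st] by auto
  qed
qed

section \<open>Alternating quadruples and crossings\<close>

text \<open>Both pairs are ordered, so each alternating choice of two elements of \<open>I\<close>
  and two of \<open>J\<close> is counted four times.\<close>

definition alternations :: "'a set \<Rightarrow> 'b set \<Rightarrow> ('a \<Rightarrow> real) \<Rightarrow> ('b \<Rightarrow> real) \<Rightarrow> real" where
  "alternations I J \<alpha> \<beta> =
     (\<Sum>i\<in>I. \<Sum>i'\<in>I. \<Sum>j\<in>J. \<Sum>j'\<in>J. of_bool (separated (\<alpha> i) (\<alpha> i') (\<beta> j) (\<beta> j')))"

text \<open>Without ties the condition is the parity of four comparisons, and exchanging the pairs
  negates all four.\<close>

lemma separated_commute: "separated s t u v \<longleftrightarrow> separated u v s t"
proof (cases "s \<in> {u, v} \<or> t \<in> {u, v}")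
  case False
  then have "u < s \<longleftrightarrow> \<not> s < u" "v < s \<longleftrightarrow> \<not> s < v" "u < t \<longleftrightarrow> \<not> t < u" "v < t \<longleftrightarrow> \<not> t < v"
    by auto
  then show ?thesis using False unfolding separated_def by simp argo
next
  case True
  then show ?thesis unfolding separated_def by blast
qed

lemma alternations_commute: "alternations I J \<alpha> \<beta> = alternations J I \<beta> \<alpha>"
proof -
  let ?g = "\<lambda>i i' j j'. of_bool (separated (\<alpha> i) (\<alpha> i') (\<beta> j) (\<beta> j')) :: real"
  have "alternations I J \<alpha> \<beta> = (\<Sum>i\<in>I. \<Sum>j\<in>J. \<Sum>i'\<in>I. \<Sum>j'\<in>J. ?g i i' j j')"
    unfolding alternations_def by (rule sum.cong[OF refl], rule sum.swap)
  also have "\<dots> = (\<Sum>j\<in>J. \<Sum>i\<in>I. \<Sum>i'\<in>I. \<Sum>j'\<in>J. ?g i i' j j')"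
    by (rule sum.swap)
  also have "\<dots> = (\<Sum>j\<in>J. \<Sum>i\<in>I. \<Sum>j'\<in>J. \<Sum>i'\<in>I. ?g i i' j j')"
    by (rule sum.cong[OF refl], rule sum.cong[OF refl], rule sum.swap)
  also have "\<dots> = (\<Sum>j\<in>J. \<Sum>j'\<in>J. \<Sum>i\<in>I. \<Sum>i'\<in>I. ?g i i' j j')"
    by (rule sum.cong[OF refl], rule sum.swap)
  also have "\<dots> = alternations J I \<beta> \<alpha>"
    unfolding alternations_def separated_commute[of "\<beta> _"] ..
  finally show ?thesis .
qed

text \<open>Four points on a circle have three perfect matchings by chords, exactly one of which
  crosses.\<close>

lemma separated_matchings:
  assumes "distinct [s, t, u, v]"
  shows "of_bool (separated s u t v) + of_bool (separated s v t u)
           = (1 - of_bool (separated s t u v) :: real)"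
proof -
  have ne: "s \<noteq> t" "s \<noteq> u" "s \<noteq> v" "t \<noteq> u" "t \<noteq> v" "u \<noteq> v" using assms by auto
  have "separated s t u v \<longleftrightarrow> ((s < u) \<noteq> (t < u)) \<noteq> ((s < v) \<noteq> (t < v))"
    "separated s u t v \<longleftrightarrow> ((s < t) \<noteq> (u < t)) \<noteq> ((s < v) \<noteq> (u < v))"
    "separated s v t u \<longleftrightarrow> ((s < t) \<noteq> (v < t)) \<noteq> ((s < u) \<noteq> (v < u))"
    using ne by (simp_all add: separated_def)
  then show ?thesis using ne by (smt (verit) of_bool_eq)
qed

text \<open>Two vertices of each kind span two pairs of disjoint edges, interchanged by swapping
  \<open>j\<close> and \<open>j'\<close>; doubling the sum joins both into one term. By
  \<open>separated_matchings\<close> that term is 1 unless the vertices alternate. Quadruples with a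
  repeated vertex contribute nothing on either side.\<close>

lemma sum_crossings_eq:
  fixes \<alpha> :: "'a \<Rightarrow> real" and \<beta> :: "'b \<Rightarrow> real"
  assumes fin: "finite I" "finite J" and inj: "inj_on \<alpha> I" "inj_on \<beta> J" and disj: "\<alpha> ` I \<inter> \<beta> ` J = {}"
  shows "2 * (\<Sum>i\<in>I. \<Sum>j\<in>J. \<Sum>i'\<in>I. \<Sum>j'\<in>J. of_bool (separated (\<alpha> i) (\<beta> j) (\<alpha> i') (\<beta> j')))
           = real (card I) * (real (card I) - 1) * (real (card J) * (real (card J) - 1))
               - alternations I J \<alpha> \<beta>"
proof -
  let ?c = "\<lambda>i i' j j'. of_bool (separated (\<alpha> i) (\<beta> j) (\<alpha> i') (\<beta> j')) :: real"
  have "(\<Sum>i\<in>I. \<Sum>j\<in>J. \<Sum>i'\<in>I. \<Sum>j'\<in>J. ?c i i' j j') = (\<Sum>i\<in>I. \<Sum>i'\<in>I. \<Sum>j\<in>J. \<Sum>j'\<in>J. ?c i i' j j')"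
    by (rule sum.cong[OF refl], rule sum.swap)
  moreover have "\<dots> = (\<Sum>i\<in>I. \<Sum>i'\<in>I. \<Sum>j\<in>J. \<Sum>j'\<in>J. ?c i i' j' j)"
    by (rule sum.cong[OF refl], rule sum.cong[OF refl], rule sum.swap)
  ultimately have "2 * (\<Sum>i\<in>I. \<Sum>j\<in>J. \<Sum>i'\<in>I. \<Sum>j'\<in>J. ?c i i' j j')
      = (\<Sum>i\<in>I. \<Sum>i'\<in>I. \<Sum>j\<in>J. \<Sum>j'\<in>J. ?c i i' j j' + ?c i i' j' j)"
    by (simp add: sum.distrib)
  also have "\<dots> = (\<Sum>i\<in>I. \<Sum>i'\<in>I. \<Sum>j\<in>J. \<Sum>j'\<in>J. (1 - of_bool (i = i')) * (1 - of_bool (j = j'))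
        - of_bool (separated (\<alpha> i) (\<alpha> i') (\<beta> j) (\<beta> j')))"
  proof (intro sum.cong refl)
    fix i i' j j' assume *: "i \<in> I" "i' \<in> I" "j \<in> J" "j' \<in> J"
    show "?c i i' j j' + ?c i i' j' j = (1 - of_bool (i = i')) * (1 - of_bool (j = j'))
        - of_bool (separated (\<alpha> i) (\<alpha> i') (\<beta> j) (\<beta> j'))"
    proof (cases "i = i' \<or> j = j'")
      case True
      then have "\<not> separated (\<alpha> i) (\<beta> j) (\<alpha> i') (\<beta> j')" "\<not> separated (\<alpha> i) (\<beta> j') (\<alpha> i') (\<beta> j)"
        "\<not> separated (\<alpha> i) (\<alpha> i') (\<beta> j) (\<beta> j')"
        unfolding separated_def by blast+
      then show ?thesis using True by auto
    next
      case False
      then have "distinct [\<alpha> i, \<alpha> i', \<beta> j, \<beta> j']"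
        using * inj disj by (auto dest: inj_onD)
      from separated_matchings[OF this] show ?thesis using False by simp
    qed
  qed
  also have "\<dots> = (\<Sum>i\<in>I. \<Sum>i'\<in>I. 1 - of_bool (i = i')) * (\<Sum>j\<in>J. \<Sum>j'\<in>J. 1 - of_bool (j = j'))
      - alternations I J \<alpha> \<beta>"
  proof -
    have product: "(\<Sum>i\<in>I. \<Sum>i'\<in>I. \<Sum>j\<in>J. \<Sum>j'\<in>J. p i i' * q j j')
        = (\<Sum>i\<in>I. \<Sum>i'\<in>I. p i i') * (\<Sum>j\<in>J. \<Sum>j'\<in>J. q j j' :: real)" for p q
      unfolding sum_distrib_left[symmetric] sum_distrib_right[symmetric] ..
    show ?thesis
      unfolding alternations_def product[symmetric] by (simp only: sum_subtractf)
  qed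
  also have "(\<Sum>i\<in>I. \<Sum>i'\<in>I. 1 - of_bool (i = i')) = real (card I) * (real (card I) - 1)"
    using fin by (simp add: sum_subtractf of_bool_def sum.delta algebra_simps)
  also have "(\<Sum>j\<in>J. \<Sum>j'\<in>J. 1 - of_bool (j = j')) = real (card J) * (real (card J) - 1)"
    using fin by (simp add: sum_subtractf of_bool_def sum.delta algebra_simps)
  finally show ?thesis .
qed

lemma sum_split_pairs:
  assumes "finite I"
  shows "(\<Sum>i\<in>I. \<Sum>i'\<in>I. of_bool (p i \<noteq> p i'))
           = 2 * (real (card {i \<in> I. p i}) * (real (card I) - real (card {i \<in> I. p i})))"
proof -
  have "(\<Sum>i\<in>I. \<Sum>i'\<in>I. of_bool (p i \<noteq> p i'))
      = (\<Sum>i\<in>I. \<Sum>i'\<in>I. of_bool (p i) * (1 - of_bool (p i')) + (1 - of_bool (p i)) * of_bool (p i') :: real)"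
    by (intro sum.cong refl) auto
  also have "\<dots> = (\<Sum>i\<in>I. of_bool (p i)) * (\<Sum>i\<in>I. 1 - of_bool (p i))
      + (\<Sum>i\<in>I. 1 - of_bool (p i)) * (\<Sum>i\<in>I. of_bool (p i))"
    by (simp only: sum.distrib sum_product)
  finally show ?thesis using assms by (simp add: sum_subtractf Int_def)
qed

text \<open>A pair of points of \<open>J\<close> is separated by a pair of points of \<open>I\<close> iff exactly one of the
  latter lies between them, and \<open>\<bar>F j - F j'\<bar>\<close> points of \<open>I\<close> lie between \<open>j\<close> and \<open>j'\<close>.\<close>

lemma alternations_eq:
  fixes \<alpha> :: "'a \<Rightarrow> real" and \<beta> :: "'b \<Rightarrow> real"
  assumes fin: "finite I" "finite J" and disj: "\<alpha> ` I \<inter> \<beta> ` J = {}"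
  defines "F \<equiv> \<lambda>j. real (card {i \<in> I. \<alpha> i < \<beta> j})"
  shows "alternations I J \<alpha> \<beta>
           = 2 * (\<Sum>j\<in>J. \<Sum>j'\<in>J. \<bar>F j - F j'\<bar> * (real (card I) - \<bar>F j - F j'\<bar>))"
proof -
  let ?p = "\<lambda>j j' i. (\<alpha> i < \<beta> j) \<noteq> (\<alpha> i < \<beta> j')"
  have between: "real (card {i \<in> I. ?p j j' i}) = F j' - F j" if "\<beta> j \<le> \<beta> j'" for j j'
  proof -
    have "{i \<in> I. \<alpha> i < \<beta> j'} = {i \<in> I. \<alpha> i < \<beta> j} \<union> {i \<in> I. ?p j j' i}"
      using that by auto
    moreover have "card ({i \<in> I. \<alpha> i < \<beta> j} \<union> {i \<in> I. ?p j j' i})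
        = card {i \<in> I. \<alpha> i < \<beta> j} + card {i \<in> I. ?p j j' i}"
      using fin that by (intro card_Un_disjoint) auto
    ultimately show ?thesis by (simp add: F_def)
  qed
  have D: "real (card {i \<in> I. ?p j j' i}) = \<bar>F j - F j'\<bar>" for j j'
  proof (cases "\<beta> j \<le> \<beta> j'")
    case True
    from between[OF this] show ?thesis by linarith
  next
    case False
    moreover have "{i \<in> I. ?p j j' i} = {i \<in> I. ?p j' j i}" by auto
    ultimately show ?thesis using between[of j' j] by simp
  qed
  have "alternations I J \<alpha> \<beta>
      = (\<Sum>j\<in>J. \<Sum>j'\<in>J. \<Sum>i\<in>I. \<Sum>i'\<in>I. of_bool (separated (\<beta> j) (\<beta> j') (\<alpha> i) (\<alpha> i')))"
    by (subst alternations_commute) (simp add: alternations_def)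
  also have "\<dots> = (\<Sum>j\<in>J. \<Sum>j'\<in>J. \<Sum>i\<in>I. \<Sum>i'\<in>I. of_bool (?p j j' i \<noteq> ?p j j' i'))"
  proof (intro sum.cong refl arg_cong[of _ _ of_bool])
    fix i i' j j' assume "i \<in> I" "i' \<in> I" "j \<in> J" "j' \<in> J"
    then have "\<alpha> i \<noteq> \<beta> j" "\<alpha> i \<noteq> \<beta> j'" "\<alpha> i' \<noteq> \<beta> j" "\<alpha> i' \<noteq> \<beta> j'"
      using disj by auto
    moreover from this have "\<beta> j < \<alpha> i \<longleftrightarrow> \<not> \<alpha> i < \<beta> j" "\<beta> j' < \<alpha> i \<longleftrightarrow> \<not> \<alpha> i < \<beta> j'"
      "\<beta> j < \<alpha> i' \<longleftrightarrow> \<not> \<alpha> i' < \<beta> j" "\<beta> j' < \<alpha> i' \<longleftrightarrow> \<not> \<alpha> i' < \<beta> j'" by auto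
    ultimately show "separated (\<beta> j) (\<beta> j') (\<alpha> i) (\<alpha> i') \<longleftrightarrow> (?p j j' i \<noteq> ?p j j' i')"
      unfolding separated_def by simp
  qed
  also have "\<dots> = (\<Sum>j\<in>J. \<Sum>j'\<in>J. 2 * (\<bar>F j - F j'\<bar> * (real (card I) - \<bar>F j - F j'\<bar>)))"
    unfolding sum_split_pairs[OF fin(1)] D ..
  finally show ?thesis by (simp add: sum_distrib_left)
qed

text \<open>The window of length \<open>2 * pi\<close> cuts the circle open at \<open>w\<close>, so
  that crossing depends on the linear order of the angles alone.\<close>

definition angles_on :: "'a set \<Rightarrow> real \<Rightarrow> ('a \<Rightarrow> real) \<Rightarrow> ('a \<Rightarrow> complex) \<Rightarrow> bool" where
  "angles_on V w t pos \<longleftrightarrow> inj_on t V \<and> t ` V \<subseteq> {w..<w + 2 * pi} \<and> (\<forall>v\<in>V. pos v = cis (t v))"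

lemma chord_angles:
  assumes "angles_on V w t pos" "u \<in> V" "v \<in> V"
  shows "chord pos {u, v} = closed_segment (cis (t u)) (cis (t v))"
  using assms by (simp add: chord_edge angles_on_def)

lemma edge_chords_meet_once:
  assumes ang: "angles_on V w t pos"
    and edges: "a \<in> V" "b \<in> V" "a \<noteq> b" "c \<in> V" "d \<in> V" "c \<noteq> d" "{a, b} \<noteq> {c, d}"
    and x: "x \<in> chord pos {a, b} \<inter> chord pos {c, d}"
    and y: "y \<in> chord pos {a, b} \<inter> chord pos {c, d}"
  shows "x = y"
proof -
  have inj: "inj_on t V" and win: "t ` V \<subseteq> {w..<w + 2 * pi}" using ang by (auto simp: angles_on_def)
  have "t ` {a, b} \<noteq> t ` {c, d}"
    using edges inj_on_image_eq_iff[OF inj, of "{a, b}" "{c, d}"] by simp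
  then have "{t a, t b} \<noteq> {t c, t d}" by simp
  moreover have "t a \<noteq> t b" "t c \<noteq> t d" using inj edges by (auto dest: inj_onD)
  moreover have "{t a, t b, t c, t d} \<subseteq> {w..<w + 2 * pi}" using win edges by auto
  ultimately show ?thesis
    using chords_meet_once[of "t a" "t b" "t c" "t d" w x y] x y chord_angles[OF ang] edges by auto
qed

lemma edge_chords_meet_iff:
  assumes ang: "angles_on V w t pos"
    and edges: "a \<in> V" "b \<in> V" "a \<noteq> b" "c \<in> V" "d \<in> V" "c \<noteq> d" "{a, b} \<noteq> {c, d}"
  shows "(\<exists>x\<in>ball 0 1. x \<in> chord pos {a, b} \<inter> chord pos {c, d})
           \<longleftrightarrow> separated (t a) (t b) (t c) (t d)"
proof -
  have inj: "inj_on t V" and win: "t ` V \<subseteq> {w..<w + 2 * pi}" using ang by (auto simp: angles_on_def)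
  have "t ` {a, b} \<noteq> t ` {c, d}"
    using edges inj_on_image_eq_iff[OF inj, of "{a, b}" "{c, d}"] by simp
  then have "{t a, t b} \<noteq> {t c, t d}" by simp
  moreover have "t a \<noteq> t b" "t c \<noteq> t d" using inj edges by (auto dest: inj_onD)
  moreover have "{t a, t b, t c, t d} \<subseteq> {w..<w + 2 * pi}" using win edges by auto
  ultimately show ?thesis
    using chords_meet_iff[of "t a" "t b" "t c" "t d" w] chord_angles[OF ang] edges by simp
qed

text \<open>These are the edges of the complete graph on \<open>V\<close>; points in general
  position for it are so for every graph on \<open>V\<close>.\<close>

definition pairs_of :: "'a set \<Rightarrow> 'a set set" where
  "pairs_of V = {{u, v} |u v. u \<in> V \<and> v \<in> V \<and> u \<noteq> v}"

lemma pairs_meet_once: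
  assumes "angles_on V w t pos" "e \<in> pairs_of V" "f \<in> pairs_of V" "e \<noteq> f"
    and "x \<in> chord pos e \<inter> chord pos f" "y \<in> chord pos e \<inter> chord pos f"
  shows "x = y"
proof -
  obtain a b c d where "e = {a, b}" "a \<in> V" "b \<in> V" "a \<noteq> b" "f = {c, d}" "c \<in> V" "d \<in> V" "c \<noteq> d"
    using assms(2,3) unfolding pairs_of_def by auto
  then show ?thesis using edge_chords_meet_once[OF assms(1)] assms(4-6) by metis
qed

lemma finite_pairs_of: "finite V \<Longrightarrow> finite (pairs_of V)"
  by (rule finite_subset[of _ "Pow V"]) (auto simp: pairs_of_def)

text \<open>There are finitely many pairs of distinct chords, each sharing at most one point.
  Finiteness keeps \<open>card\<close> from defaulting to 0 and leaves room for the choice of angles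
  in \<open>generic_angles\<close>.\<close>

lemma finite_crossing_points:
  assumes ang: "angles_on V w t pos" and fin: "finite V" and E: "E \<subseteq> pairs_of V"
  shows "finite (crossing_points E pos)"
proof -
  have "finite E" using finite_pairs_of[OF fin] E by (rule rev_finite_subset)
  have "crossing_points E pos \<subseteq> (\<Union>e\<in>E. \<Union>f\<in>E - {e}. chord pos e \<inter> chord pos f)"
    by (auto simp: crossing_points_def)
  moreover have "finite (chord pos e \<inter> chord pos f)" if "e \<in> E" "f \<in> E - {e}" for e f
  proof -
    have "x = y" if "x \<in> chord pos e \<inter> chord pos f" "y \<in> chord pos e \<inter> chord pos f" for x y
      using pairs_meet_once[OF ang _ _ _ that] \<open>e \<in> E\<close> \<open>f \<in> E - {e}\<close> E by auto
    then have "\<exists>x. chord pos e \<inter> chord pos f \<subseteq> {x}" by blast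
    then show ?thesis by (meson finite.emptyI finite.insertI finite_subset)
  qed
  then have "finite (\<Union>e\<in>E. \<Union>f\<in>E - {e}. chord pos e \<inter> chord pos f)"
    using \<open>finite E\<close> by blast
  ultimately show ?thesis by (rule finite_subset)
qed

text \<open>Exactly two chords pass through each crossing point, so it comes from two ordered pairs
  of edges; distinct points come from different pairs because two chords meet only once.\<close>

lemma card_crossing_points:
  assumes ang: "angles_on V w t pos" and fin: "finite V" and E: "E \<subseteq> pairs_of V"
    and simple: "\<forall>x\<in>crossing_points E pos. card {e \<in> E. x \<in> chord pos e} \<le> 2"
  shows "2 * card (crossing_points E pos)
           = card {(e, f). e \<in> E \<and> f \<in> E \<and> e \<noteq> f \<and> (\<exists>x\<in>ball 0 1. x \<in> chord pos e \<inter> chord pos f)}"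
proof -
  have finE: "finite E" using finite_pairs_of[OF fin] E by (rule rev_finite_subset)
  define R where "R x = {(e, f). e \<in> E \<and> f \<in> E \<and> e \<noteq> f \<and> x \<in> chord pos e \<inter> chord pos f}" for x
  have card_R: "card (R x) = 2" if x: "x \<in> crossing_points E pos" for x
  proof -
    obtain e f where ef: "e \<in> E" "f \<in> E" "e \<noteq> f" "x \<in> chord pos e \<inter> chord pos f"
      using x by (auto simp: crossing_points_def)
    have "{e, f} = {e \<in> E. x \<in> chord pos e}"
      using ef simple x finE by (intro card_seteq) auto
    then have "R x = {(e, f), (f, e)}" using ef unfolding R_def by blast
    then show ?thesis using ef by simp
  qed
  have "{(e, f). e \<in> E \<and> f \<in> E \<and> e \<noteq> f \<and> (\<exists>x\<in>ball 0 1. x \<in> chord pos e \<inter> chord pos f)}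
      = (\<Union>x\<in>crossing_points E pos. R x)"
    unfolding R_def crossing_points_def by blast
  moreover have "card (\<Union>x\<in>crossing_points E pos. R x) = (\<Sum>x\<in>crossing_points E pos. card (R x))"
  proof (rule card_UN_disjoint)
    show "\<forall>x\<in>crossing_points E pos. finite (R x)"
      using finE by (auto simp: R_def intro: finite_subset[of _ "E \<times> E"])
    show "\<forall>x\<in>crossing_points E pos. \<forall>y\<in>crossing_points E pos. x \<noteq> y \<longrightarrow> R x \<inter> R y = {}"
      using pairs_meet_once[OF ang] E unfolding R_def by blast
  qed (rule finite_crossing_points[OF ang fin E])
  ultimately show ?thesis using card_R by simp
qed

section \<open>The lower bound\<close>

lemma finite_K_verts: "finite (K_verts m n)"
  by (simp add: K_verts_def)

lemma K_edges_subset: "K_edges m n \<subseteq> pairs_of (K_verts m n)"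
  by (fastforce simp: K_edges_def pairs_of_def K_verts_def)

text \<open>The ends of an edge are told apart by \<open>Inl\<close> and \<open>Inr\<close>, so
  ordered pairs of edges correspond one to one to index quadruples; separation already excludes
  equal edges.\<close>

lemma K_edges_crossing_pairs:
  assumes ang: "angles_on (K_verts m n) w t pos"
  shows "card {(e, f). e \<in> K_edges m n \<and> f \<in> K_edges m n \<and> e \<noteq> f
             \<and> (\<exists>x\<in>ball 0 1. x \<in> chord pos e \<inter> chord pos f)}
           = card {(i, j, i', j'). i < m \<and> j < n \<and> i' < m \<and> j' < n
               \<and> separated (t (Inl i)) (t (Inr j)) (t (Inl i')) (t (Inr j'))}"
    (is "card ?L = card ?R")
proof -
  define \<phi> :: "nat \<times> nat \<times> nat \<times> nat \<Rightarrow> (nat + nat) set \<times> (nat + nat) set"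
    where "\<phi> = (\<lambda>(i, j, i', j'). ({Inl i, Inr j}, {Inl i', Inr j'}))"
  have inj: "inj_on \<phi> ?R"
    by (auto simp: inj_on_def \<phi>_def doubleton_eq_iff)
  define Q where "Q e f \<longleftrightarrow> (\<exists>x\<in>ball 0 1. x \<in> chord pos e \<inter> chord pos f)" for e f :: "(nat + nat) set"
  have meet: "Q {Inl i, Inr j} {Inl i', Inr j'}
      \<longleftrightarrow> separated (t (Inl i)) (t (Inr j)) (t (Inl i')) (t (Inr j'))"
    if "i < m" "j < n" "i' < m" "j' < n" "{Inl i, Inr j} \<noteq> {Inl i', Inr j'}" for i j i' j'
    unfolding Q_def by (rule edge_chords_meet_iff[OF ang]) (use that in \<open>auto simp: K_verts_def\<close>)
  have ne: "{Inl i, Inr j} \<noteq> {Inl i', Inr j'}"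
    if "separated (t (Inl i)) (t (Inr j)) (t (Inl i')) (t (Inr j'))" for i j i' j'
    using that by (auto simp: separated_def doubleton_eq_iff)
  have "\<phi> ` ?R = {(e, f). e \<in> K_edges m n \<and> f \<in> K_edges m n \<and> e \<noteq> f \<and> Q e f}" (is "_ = ?L'")
  proof (intro equalityI subsetI)
    fix z assume "z \<in> \<phi> ` ?R"
    then obtain i j i' j' where z: "z = ({Inl i, Inr j}, {Inl i', Inr j'})"
      and *: "i < m" "j < n" "i' < m" "j' < n"
        "separated (t (Inl i)) (t (Inr j)) (t (Inl i')) (t (Inr j'))"
      unfolding \<phi>_def by auto
    have "{Inl i, Inr j} \<in> K_edges m n" "{Inl i', Inr j'} \<in> K_edges m n"
      using * unfolding K_edges_def by blast+
    then show "z \<in> ?L'" using meet[OF *(1-4)] ne[OF *(5)] *(5) unfolding z by simp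
  next
    fix z assume "z \<in> ?L'"
    then obtain i j i' j' where z: "z = ({Inl i, Inr j}, {Inl i', Inr j'})"
      and *: "i < m" "j < n" "i' < m" "j' < n" "{Inl i, Inr j} \<noteq> {Inl i', Inr j'}"
        "Q {Inl i, Inr j} {Inl i', Inr j'}"
      unfolding K_edges_def by blast
    then have "(i, j, i', j') \<in> ?R" using meet[OF *(1-5)] by simp
    then show "z \<in> \<phi> ` ?R" unfolding z \<phi>_def by force
  qed
  then show ?thesis using card_image[OF inj] by (simp add: Q_def)
qed

lemma real_choose_two: "2 * real (m choose 2) = real m * (real m - 1)"
  by (induction m) (simp_all add: numeral_2_eq_2 algebra_simps)

text \<open>Everything is multiplied by 4: one factor 2 comes from ordered pairs of edges, the other
  from \<open>sum_crossings_eq\<close>, and the two binomial coefficients absorb them.\<close>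

lemma card_K_crossing_points:
  assumes ang: "angles_on (K_verts m n) w t pos"
    and simple: "\<forall>x\<in>crossing_points (K_edges m n) pos. card {e \<in> K_edges m n. x \<in> chord pos e} \<le> 2"
  shows "real (card (crossing_points (K_edges m n) pos))
           = real (m choose 2) * real (n choose 2)
             - alternations {..<m} {..<n} (t \<circ> Inl) (t \<circ> Inr) / 4"
proof -
  let ?\<alpha> = "t \<circ> Inl" and ?\<beta> = "t \<circ> Inr"
  let ?X = "crossing_points (K_edges m n) pos"
  have inj: "inj_on t (K_verts m n)" using ang by (simp add: angles_on_def)
  let ?R = "{(i, j, i', j'). i < m \<and> j < n \<and> i' < m \<and> j' < n
      \<and> separated (?\<alpha> i) (?\<beta> j) (?\<alpha> i') (?\<beta> j')}"
  let ?B = "{..<m} \<times> {..<n} \<times> {..<m} \<times> {..<n}"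
  have "real (card ?R) = real (card {x \<in> ?B. case x of (i, j, i', j') \<Rightarrow> separated (?\<alpha> i) (?\<beta> j) (?\<alpha> i') (?\<beta> j')})"
    by (intro arg_cong[of _ _ real] arg_cong[of _ _ card]) auto
  also have "\<dots> = (\<Sum>x\<in>?B. of_bool (case x of (i, j, i', j') \<Rightarrow> separated (?\<alpha> i) (?\<beta> j) (?\<alpha> i') (?\<beta> j')))"
    by (simp add: Int_def)
  also have "\<dots> = (\<Sum>i<m. \<Sum>j<n. \<Sum>i'<m. \<Sum>j'<n. of_bool (separated (?\<alpha> i) (?\<beta> j) (?\<alpha> i') (?\<beta> j')))"
    unfolding sum.cartesian_product' by simp
  finally have R: "real (card ?R)
      = (\<Sum>i<m. \<Sum>j<n. \<Sum>i'<m. \<Sum>j'<n. of_bool (separated (?\<alpha> i) (?\<beta> j) (?\<alpha> i') (?\<beta> j')))" .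
  have "2 * card ?X = card ?R"
    unfolding card_crossing_points[OF ang finite_K_verts K_edges_subset simple]
      K_edges_crossing_pairs[OF ang] by simp
  then have "4 * real (card ?X) = 2 * real (card ?R)" by linarith
  also have "\<dots> = real m * (real m - 1) * (real n * (real n - 1)) - alternations {..<m} {..<n} ?\<alpha> ?\<beta>"
  proof -
    have "inj_on ?\<alpha> {..<m}" "inj_on ?\<beta> {..<n}" "?\<alpha> ` {..<m} \<inter> ?\<beta> ` {..<n} = {}"
      using inj by (auto simp: inj_on_def K_verts_def)
    then show ?thesis unfolding R by (subst sum_crossings_eq) auto
  qed
  finally show ?thesis unfolding real_choose_two[symmetric] by simp
qed

section \<open>Angles of a drawing and the number of parts of each kind\<close>

lemma arc_division_mono:
  assumes "arc_division p \<theta>" "i \<le> j" "j \<le> p"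
  shows "\<theta> i \<le> \<theta> j"
  using assms(2,3)
proof (induction j rule: dec_induct)
  case (step j)
  then have "\<theta> j < \<theta> (Suc j)" using assms(1) by (auto simp: arc_division_def)
  then show ?case using step by simp
qed simp

lemma drawing_angles:
  assumes draw: "circular_drawing p V E P \<theta> pos"
  obtains t where "angles_on V (\<theta> 0) t pos"
    and "\<And>i v. i < p \<Longrightarrow> v \<in> P i \<Longrightarrow> \<theta> i \<le> t v \<and> t v < \<theta> (Suc i)"
proof -
  have arc: "arc_division p \<theta>" and inj: "inj_on pos V" and V: "(\<Union>i<p. P i) = V"
    and disj: "disjoint_family_on P {..<p}"
    using draw by (auto simp: circular_drawing_def numbered_partition_def)
  \<comment> \<open>The claim covers every \<open>i\<close> at once so that the chosen angle depends
    on \<open>v\<close> only; disjointness of the parts leaves a single \<open>i\<close> to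
    satisfy.\<close>
  have "\<exists>s. \<forall>i<p. v \<in> P i \<longrightarrow> \<theta> i \<le> s \<and> s < \<theta> (Suc i) \<and> pos v = cis s" if "v \<in> V" for v
  proof -
    obtain i where i: "i < p" "v \<in> P i" using V \<open>v \<in> V\<close> by blast
    then have "pos v \<in> arc_segment \<theta> i" using draw by (auto simp: circular_drawing_def)
    then obtain s where "\<theta> i \<le> s" "s < \<theta> (Suc i)" "pos v = cis s" by (auto simp: arc_segment_def)
    moreover have "j = i" if "j < p" "v \<in> P j" for j
      using disjoint_family_onD[OF disj, of i j] i that by auto
    ultimately show ?thesis by blast
  qed
  then obtain t where t: "\<And>v i. v \<in> V \<Longrightarrow> i < p \<Longrightarrow> v \<in> P i \<Longrightarrow> \<theta> i \<le> t v \<and> t v < \<theta> (Suc i) \<and> pos v = cis (t v)"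
    by metis
  have part: "\<theta> i \<le> t v \<and> t v < \<theta> (Suc i) \<and> pos v = cis (t v)" if "i < p" "v \<in> P i" for i v
    using t that V by blast
  have "inj_on t V"
    using inj part V unfolding inj_on_def by (metis UN_iff lessThan_iff)
  moreover have "t v \<in> {\<theta> 0..<\<theta> 0 + 2 * pi}" if v: "v \<in> V" for v
  proof -
    obtain i where i: "i < p" "v \<in> P i" using V v by blast
    have "\<theta> 0 \<le> \<theta> i" "\<theta> (Suc i) \<le> \<theta> p" using i by (auto intro: arc_division_mono[OF arc])
    then show ?thesis using part[OF i] arc by (auto simp: arc_division_def)
  qed
  moreover have "pos v = cis (t v)" if "v \<in> V" for v using part that V by blast
  ultimately have "angles_on V (\<theta> 0) t pos" by (auto simp: angles_on_def)
  then show thesis using part that by blast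
qed

text \<open>No \<open>\<alpha> i\<close> lies in an arc with index in \<open>L\<close>, so every
  \<open>\<beta> j\<close> in such an arc is preceded by the same \<open>\<alpha> i\<close> as the
  start \<open>\<theta> l\<close> of the arc.\<close>

lemma card_rank_values:
  fixes \<alpha> \<beta> :: "nat \<Rightarrow> real"
  assumes part: "\<And>j. j < n \<Longrightarrow> \<exists>l\<in>L. \<theta> l \<le> \<beta> j \<and> \<beta> j < \<theta> (Suc l)"
    and outside: "\<And>i l. i < m \<Longrightarrow> l \<in> L \<Longrightarrow> \<alpha> i < \<theta> l \<or> \<theta> (Suc l) \<le> \<alpha> i"
    and L: "finite L"
  shows "card ((\<lambda>j. real (card {i \<in> {..<m}. \<alpha> i < \<beta> j})) ` {..<n}) \<le> card L"
proof -
  have "(\<lambda>j. real (card {i \<in> {..<m}. \<alpha> i < \<beta> j})) ` {..<n}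
      \<subseteq> (\<lambda>l. real (card {i \<in> {..<m}. \<alpha> i < \<theta> l})) ` L"
  proof (rule image_subsetI)
    fix j assume "j \<in> {..<n}"
    then obtain l where l: "l \<in> L" "\<theta> l \<le> \<beta> j" "\<beta> j < \<theta> (Suc l)" using part by auto
    then have "{i \<in> {..<m}. \<alpha> i < \<beta> j} = {i \<in> {..<m}. \<alpha> i < \<theta> l}"
      using outside[OF _ l(1)] by force
    then show "real (card {i \<in> {..<m}. \<alpha> i < \<beta> j})
        \<in> (\<lambda>l. real (card {i \<in> {..<m}. \<alpha> i < \<theta> l})) ` L"
      using l(1) by auto
  qed
  from card_mono[OF finite_imageI[OF L] this] card_image_le[OF L] show ?thesis by (rule order_trans)
qed

lemma alternations_le:
  fixes \<alpha> \<beta> :: "nat \<Rightarrow> real"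
  assumes disj: "\<alpha> ` {..<m} \<inter> \<beta> ` {..<n} = {}" and "k > 0"
    and k: "card ((\<lambda>j. real (card {i \<in> {..<m}. \<alpha> i < \<beta> j})) ` {..<n}) \<le> k"
  shows "alternations {..<m} {..<n} \<alpha> \<beta> \<le> real m ^ 2 * real n ^ 2 * (1 - 1 / real k ^ 2) / 3"
  using pair_energy_bound[OF _ k \<open>k > 0\<close>, of "real m"] alternations_eq[OF _ _ disj] by simp

text \<open>A left and a right vertex are always adjacent, so no part holds both kinds. Hence one of
  the kinds occupies at most \<open>k\<close> of the \<open>2 * k\<close> parts, and the
  alternations are counted from that side; \<open>alternations_commute\<close> permits the
  exchange.\<close>

lemma K_drawing_alternations_le:
  assumes draw: "circular_drawing (2 * k) (K_verts m n) (K_edges m n) P \<theta> pos" and "k > 0"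
    and ang: "angles_on (K_verts m n) (\<theta> 0) t pos"
    and t: "\<And>i v. i < 2 * k \<Longrightarrow> v \<in> P i \<Longrightarrow> \<theta> i \<le> t v \<and> t v < \<theta> (Suc i)"
  shows "alternations {..<m} {..<n} (t \<circ> Inl) (t \<circ> Inr)
           \<le> real m ^ 2 * real n ^ 2 * (1 - 1 / real k ^ 2) / 3"
proof -
  let ?\<alpha> = "t \<circ> Inl" and ?\<beta> = "t \<circ> Inr"
  define A where "A = {l. l < 2 * k \<and> (\<exists>i<m. Inl i \<in> P l)}"
  define B where "B = {l. l < 2 * k \<and> (\<exists>j<n. Inr j \<in> P l)}"
  have arc: "arc_division (2 * k) \<theta>" and V: "(\<Union>i<2 * k. P i) = K_verts m n"
    and indep: "\<And>l. l < 2 * k \<Longrightarrow> independent_set (K_edges m n) (P l)"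
    using draw by (auto simp: circular_drawing_def numbered_partition_def)
  have mono: "\<theta> i \<le> \<theta> j" if "i \<le> j" "j \<le> 2 * k" for i j
    using arc_division_mono[OF arc that] .
  have "A \<inter> B = {}"
  proof (rule equals0I)
    fix l assume "l \<in> A \<inter> B"
    then obtain i j where "l < 2 * k" "i < m" "Inl i \<in> P l" "j < n" "Inr j \<in> P l"
      by (auto simp: A_def B_def)
    moreover have "{Inl i, Inr j} \<in> K_edges m n" using \<open>i < m\<close> \<open>j < n\<close> by (auto simp: K_edges_def)
    ultimately show False using indep[of l] by (auto simp: independent_set_def)
  qed
  moreover have finAB: "finite A" "finite B" by (auto simp: A_def B_def)
  ultimately have "card A + card B = card (A \<union> B)" by (simp add: card_Un_disjoint)
  also have "\<dots> \<le> card {..<2 * k}" by (intro card_mono) (auto simp: A_def B_def)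
  finally have small: "card A \<le> k \<or> card B \<le> k" by auto
  have apart: "t u < \<theta> l \<or> \<theta> (Suc l) \<le> t u" if "u \<in> P l'" "l' < 2 * k" "l < 2 * k" "l \<noteq> l'" for u l l'
  proof (cases "l' < l")
    case True
    then show ?thesis using t[OF that(2,1)] mono[of "Suc l'" l] that by auto
  next
    case False
    then show ?thesis using t[OF that(2,1)] mono[of "Suc l" l'] that by auto
  qed
  have inA: "\<exists>l\<in>A. Inl i \<in> P l" if "i < m" for i
  proof -
    have "Inl i \<in> K_verts m n" using that by (auto simp: K_verts_def)
    then show ?thesis using V that unfolding A_def by blast
  qed
  have inB: "\<exists>l\<in>B. Inr j \<in> P l" if "j < n" for j
  proof -
    have "Inr j \<in> K_verts m n" using that by (auto simp: K_verts_def)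
    then show ?thesis using V that unfolding B_def by blast
  qed
  have disj: "?\<alpha> ` {..<m} \<inter> ?\<beta> ` {..<n} = {}"
    using ang by (auto simp: angles_on_def inj_on_def K_verts_def)
  show ?thesis
  proof (cases "card B \<le> k")
    case True
    have "card ((\<lambda>j. real (card {i \<in> {..<m}. ?\<alpha> i < ?\<beta> j})) ` {..<n}) \<le> card B"
    proof (rule card_rank_values[where \<theta> = \<theta>])
      fix j assume "j < n"
      then show "\<exists>l\<in>B. \<theta> l \<le> ?\<beta> j \<and> ?\<beta> j < \<theta> (Suc l)"
        using inB t by (fastforce simp: B_def)
    next
      fix i l assume "i < m" "l \<in> B"
      moreover obtain l' where "l' \<in> A" "Inl i \<in> P l'" using inA \<open>i < m\<close> by blast
      ultimately show "?\<alpha> i < \<theta> l \<or> \<theta> (Suc l) \<le> ?\<alpha> i"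
        using apart[of "Inl i" l' l] \<open>A \<inter> B = {}\<close> by (auto simp: A_def B_def)
    qed (rule finAB)
    with True show ?thesis by (intro alternations_le disj \<open>k > 0\<close>) simp
  next
    case False
    then have k: "card A \<le> k" using small by simp
    have "card ((\<lambda>i. real (card {j \<in> {..<n}. ?\<beta> j < ?\<alpha> i})) ` {..<m}) \<le> card A"
    proof (rule card_rank_values[where \<theta> = \<theta>])
      fix i assume "i < m"
      then show "\<exists>l\<in>A. \<theta> l \<le> ?\<alpha> i \<and> ?\<alpha> i < \<theta> (Suc l)"
        using inA t by (fastforce simp: A_def)
    next
      fix j l assume "j < n" "l \<in> A"
      moreover obtain l' where "l' \<in> B" "Inr j \<in> P l'" using inB \<open>j < n\<close> by blast
      ultimately show "?\<beta> j < \<theta> l \<or> \<theta> (Suc l) \<le> ?\<beta> j"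
        using apart[of "Inr j" l' l] \<open>A \<inter> B = {}\<close> by (auto simp: A_def B_def)
    qed (rule finAB)
    with k have "alternations {..<n} {..<m} ?\<beta> ?\<alpha> \<le> real n ^ 2 * real m ^ 2 * (1 - 1 / real k ^ 2) / 3"
      using disj by (intro alternations_le \<open>k > 0\<close>) auto
    then show ?thesis by (subst alternations_commute) (simp add: mult.commute)
  qed
qed

lemma K_drawing_crossings_ge:
  assumes draw: "circular_drawing (2 * k) (K_verts m n) (K_edges m n) P \<theta> pos" and "k > 0"
  shows "real (m choose 2) * real (n choose 2) - real m ^ 2 * real n ^ 2 * (1 - 1 / real k ^ 2) / 12
           \<le> real (card (crossing_points (K_edges m n) pos))"
proof -
  obtain t where t: "angles_on (K_verts m n) (\<theta> 0) t pos"
    "\<And>i v. i < 2 * k \<Longrightarrow> v \<in> P i \<Longrightarrow> \<theta> i \<le> t v \<and> t v < \<theta> (Suc i)"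
    using drawing_angles[OF draw] by blast
  have "\<forall>x\<in>crossing_points (K_edges m n) pos. card {e \<in> K_edges m n. x \<in> chord pos e} \<le> 2"
    using draw by (simp add: circular_drawing_def)
  from card_K_crossing_points[OF t(1) this] K_drawing_alternations_le[OF draw \<open>k > 0\<close> t]
  show ?thesis by simp
qed

section \<open>Drawings in general position\<close>

lemma pairs_of_insert: "pairs_of (insert a V) = pairs_of V \<union> {{a, p} |p. p \<in> V \<and> p \<noteq> a}"
  unfolding pairs_of_def by (auto simp: insert_commute)

text \<open>If \<open>u\<close> and \<open>v\<close> differed, two chords sharing an end would meet
  inside the disk, although \<open>separated\<close> fails for a repeated endpoint.\<close>

lemma chords_with_common_end:
  assumes "{s, u, v} \<subseteq> {w..<w + 2 * pi}" "s \<noteq> u" "s \<noteq> v" "norm x < 1"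
    and "x \<in> closed_segment (cis s) (cis u)" "x \<in> closed_segment (cis s) (cis v)"
  shows "u = v"
proof (rule ccontr)
  assume "u \<noteq> v"
  have "{s, u, s, v} \<subseteq> {w..<w + 2 * pi}" "{s, u} \<noteq> {s, v}"
    using assms(1) \<open>u \<noteq> v\<close> \<open>s \<noteq> u\<close> by (auto simp: doubleton_eq_iff)
  from chords_meet_iff[OF this(1) assms(2,3) this(2)] have "separated s u s v"
    using assms(4-6) by auto
  then show False by (simp add: separated_def)
qed

text \<open>A new point destroys general position only if it is collinear with an old crossing and an
  old point, which excludes finitely many angles.\<close>

lemma generic_angles:
  fixes lo hi :: "'a \<Rightarrow> real"
  assumes "finite V" "\<And>v. v \<in> V \<Longrightarrow> lo v < hi v \<and> w \<le> lo v \<and> hi v \<le> w + 2 * pi"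
  shows "\<exists>t. inj_on t V \<and> (\<forall>v\<in>V. lo v \<le> t v \<and> t v < hi v) \<and>
           (\<forall>x\<in>ball 0 1. card {e \<in> pairs_of V. x \<in> chord (cis \<circ> t) e} \<le> 2)"
  using assms
proof (induction V rule: finite_induct)
  case empty
  then show ?case by (simp add: pairs_of_def)
next
  case (insert a V)
  obtain t where "inj_on t V \<and> (\<forall>v\<in>V. lo v \<le> t v \<and> t v < hi v) \<and>
      (\<forall>x\<in>ball 0 1. card {e \<in> pairs_of V. x \<in> chord (cis \<circ> t) e} \<le> 2)"
    using insert.IH[OF insert.prems[OF insertI2]] by meson
  then have inj: "inj_on t V" and t: "\<And>v. v \<in> V \<Longrightarrow> lo v \<le> t v \<and> t v < hi v"
    and generic: "\<And>x. x \<in> ball 0 1 \<Longrightarrow> card {e \<in> pairs_of V. x \<in> chord (cis \<circ> t) e} \<le> 2"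
    by blast+
  have win: "t v \<in> {w..<w + 2 * pi}" if "v \<in> V" for v
    using t[OF that] insert.prems[of v] that by auto
  have ang: "angles_on V w t (cis \<circ> t)" using inj win by (auto simp: angles_on_def)
  define X where "X = crossing_points (pairs_of V) (cis \<circ> t)"
  \<comment> \<open>The angles whose chord to \<open>p\<close> passes through the old crossing
    \<open>x\<close>; two chords from \<open>p\<close> share no point inside the disk, so there is
    at most one.\<close>
  define bad where "bad x p = {u \<in> {w..<w + 2 * pi}. t p \<noteq> u \<and> x \<in> closed_segment (cis (t p)) (cis u)}"
    for x p
  have "finite (bad x p)" if "x \<in> X" "p \<in> V" for x p
  proof -
    have "norm x < 1" using \<open>x \<in> X\<close> by (simp add: X_def crossing_points_def)
    then have "u = u'" if "u \<in> bad x p" "u' \<in> bad x p" for u u'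
      using chords_with_common_end[of "t p" u u' w x] win[OF \<open>p \<in> V\<close>] that by (simp add: bad_def)
    then have "\<exists>u. bad x p \<subseteq> {u}" by blast
    then show ?thesis by (meson finite.emptyI finite.insertI finite_subset)
  qed
  moreover have "finite X"
    unfolding X_def by (rule finite_crossing_points[OF ang insert.hyps(1) order_refl])
  ultimately have "finite (t ` V \<union> (\<Union>x\<in>X. \<Union>p\<in>V. bad x p))" using insert.hyps(1) by blast
  \<comment> \<open>Removing finitely many angles from the open arc of \<open>a\<close> leaves some
    angle.\<close>
  moreover have "infinite {lo a<..<hi a}" using insert.prems[of a] by simp
  ultimately have "\<not> {lo a<..<hi a} \<subseteq> t ` V \<union> (\<Union>x\<in>X. \<Union>p\<in>V. bad x p)"
    using finite_subset by blast
  then obtain u where u: "u \<in> {lo a<..<hi a}" "u \<notin> t ` V" "\<And>x p. x \<in> X \<Longrightarrow> p \<in> V \<Longrightarrow> u \<notin> bad x p"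
    by blast
  define t' where "t' = t(a := u)"
  have t'_old: "t' v = t v" if "v \<in> V" for v using that insert.hyps(2) by (auto simp: t'_def)
  have u_win: "u \<in> {w..<w + 2 * pi}" using u(1) insert.prems[of a] by auto
  have "inj_on t' (insert a V)"
    using inj u(2) insert.hyps(2) unfolding t'_def by (auto simp: inj_on_def)
  moreover have "\<forall>v\<in>insert a V. lo v \<le> t' v \<and> t' v < hi v"
    using t u(1) t'_old by (auto simp: t'_def)
  moreover have "\<forall>x\<in>ball 0 1. card {e \<in> pairs_of (insert a V). x \<in> chord (cis \<circ> t') e} \<le> 2"
  proof
    fix x :: complex assume x: "x \<in> ball 0 1"
    define old where "old = {e \<in> pairs_of V. x \<in> chord (cis \<circ> t) e}"
    define new where "new = {p \<in> V. x \<in> closed_segment (cis (t p)) (cis u)}"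
    have chord_old: "chord (cis \<circ> t') e = chord (cis \<circ> t) e" if "e \<in> pairs_of V" for e
    proof -
      have "e \<subseteq> V" using that by (auto simp: pairs_of_def)
      then have "(cis \<circ> t') ` e = (cis \<circ> t) ` e" using t'_old by (intro image_cong) auto
      then show ?thesis by (simp add: chord_def)
    qed
    have chord_new: "chord (cis \<circ> t') {a, p} = closed_segment (cis (t p)) (cis u)" if "p \<in> V" for p
      using t'_old[OF that] by (simp add: chord_edge t'_def closed_segment_commute)
    have split: "{e \<in> pairs_of (insert a V). x \<in> chord (cis \<circ> t') e} = old \<union> (\<lambda>p. {a, p}) ` new"
    proof -
      have "{e \<in> pairs_of V. x \<in> chord (cis \<circ> t') e} = old"
        using chord_old by (auto simp: old_def)
      moreover have "{e. (\<exists>p. e = {a, p} \<and> p \<in> V \<and> p \<noteq> a) \<and> x \<in> chord (cis \<circ> t') e} = (\<lambda>p. {a, p}) ` new"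
        (is "?L = ?R")
      proof (intro equalityI subsetI)
        fix e assume "e \<in> ?L"
        then show "e \<in> ?R" using chord_new by (auto simp: new_def)
      next
        fix e assume "e \<in> ?R"
        then obtain p where "e = {a, p}" "p \<in> V" "x \<in> closed_segment (cis (t p)) (cis u)"
          by (auto simp: new_def)
        then show "e \<in> ?L" using chord_new insert.hyps(2) by auto
      qed
      moreover have "{e \<in> A \<union> {f. Q f}. R e} = {e \<in> A. R e} \<union> {e. Q e \<and> R e}" for A :: "'a set set" and Q R
        by auto
      ultimately show ?thesis unfolding pairs_of_insert by simp
    qed
    have ne: "t p \<noteq> u" if "p \<in> V" for p using u(2) that by auto
    have fin: "finite old" "finite new"
      using insert.hyps(1) finite_pairs_of[OF insert.hyps(1)] by (auto simp: old_def new_def)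
    \<comment> \<open>Any two new chords share the end \<open>cis u\<close>, so at most one of them
      passes through a point \<open>x\<close> of the open disk.\<close>
    have new_le: "card new \<le> 1"
    proof -
      have "p = p'" if "p \<in> new" "p' \<in> new" for p p'
      proof -
        have "p \<in> V" "p' \<in> V" using that by (auto simp: new_def)
        then have "t p = t p'"
          using chords_with_common_end[of u "t p" "t p'" w x] win u_win ne[of p] ne[of p'] x that
          by (auto simp: new_def closed_segment_commute)
        then show ?thesis using inj \<open>p \<in> V\<close> \<open>p' \<in> V\<close> by (auto dest: inj_onD)
      qed
      then show ?thesis using fin by (metis One_nat_def card_le_Suc0_iff_eq)
    qed
    show "card {e \<in> pairs_of (insert a V). x \<in> chord (cis \<circ> t') e} \<le> 2"
    proof (cases "new = {}")
      case True
      then show ?thesis using generic[OF x] by (simp add: split old_def)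
    next
      case False
      then obtain p where p: "p \<in> V" "x \<in> closed_segment (cis (t p)) (cis u)" by (auto simp: new_def)
      \<comment> \<open>When a new chord passes through \<open>x\<close>, the choice of
        \<open>u\<close> ensures that \<open>x\<close> is no old crossing, so at most one old chord
        contains it.\<close>
      then have "u \<in> bad x p" using ne u_win by (simp add: bad_def)
      then have "x \<notin> X" using u(3) p(1) by blast
      have "e = f" if "e \<in> old" "f \<in> old" for e f
      proof (rule ccontr)
        assume "e \<noteq> f"
        then have "x \<in> X" using that x unfolding X_def crossing_points_def old_def by blast
        then show False using \<open>x \<notin> X\<close> by simp
      qed
      then have "card old \<le> 1" using fin by (metis One_nat_def card_le_Suc0_iff_eq)
      moreover have "card ((\<lambda>p. {a, p}) ` new) \<le> card new" by (rule card_image_le) (rule fin)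
      ultimately show ?thesis using card_Un_le[of old "(\<lambda>p. {a, p}) ` new"] new_le by (simp add: split)
    qed
  qed
  ultimately show ?case by (intro exI[of _ t'] conjI)
qed

text \<open>Angles generic for all chords on \<open>V\<close> are chosen inside the arcs prescribed
  by the parts; passing to the edge set \<open>E\<close> only removes chords through a
  point.\<close>

lemma circular_drawing_exists:
  assumes fin: "finite V" and E: "E \<subseteq> pairs_of V" and P: "numbered_partition p V E P"
    and arc: "arc_division p \<theta>"
  shows "\<exists>pos. circular_drawing p V E P \<theta> pos"
proof -
  have V: "(\<Union>i<p. P i) = V" and disj: "disjoint_family_on P {..<p}"
    using P by (auto simp: numbered_partition_def)
  have "\<exists>i<p. v \<in> P i" if "v \<in> V" for v using that V by blast
  then obtain idx where idx: "\<And>v. v \<in> V \<Longrightarrow> idx v < p \<and> v \<in> P (idx v)" by metis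
  have unique: "idx v = i" if "i < p" "v \<in> P i" for v i
  proof -
    have "v \<in> V" using that V by blast
    then show ?thesis using disjoint_family_onD[OF disj, of i "idx v"] idx that by auto
  qed
  have "\<theta> (idx v) < \<theta> (Suc (idx v)) \<and> \<theta> 0 \<le> \<theta> (idx v) \<and> \<theta> (Suc (idx v)) \<le> \<theta> 0 + 2 * pi"
    if "v \<in> V" for v
    using idx[OF that] arc_division_mono[OF arc, of 0 "idx v"]
      arc_division_mono[OF arc, of "Suc (idx v)" p] arc by (auto simp: arc_division_def)
  from generic_angles[where lo = "\<lambda>v. \<theta> (idx v)" and hi = "\<lambda>v. \<theta> (Suc (idx v))", OF fin this]
  obtain t where "inj_on t V \<and> (\<forall>v\<in>V. \<theta> (idx v) \<le> t v \<and> t v < \<theta> (Suc (idx v))) \<and>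
      (\<forall>x\<in>ball 0 1. card {e \<in> pairs_of V. x \<in> chord (cis \<circ> t) e} \<le> 2)"
    by meson
  then have inj: "inj_on t V" and t: "\<And>v. v \<in> V \<Longrightarrow> \<theta> (idx v) \<le> t v \<and> t v < \<theta> (Suc (idx v))"
    and generic: "\<And>x. x \<in> ball 0 1 \<Longrightarrow> card {e \<in> pairs_of V. x \<in> chord (cis \<circ> t) e} \<le> 2"
    by blast+
  have "t ` V \<subseteq> {\<theta> 0..<\<theta> 0 + 2 * pi}"
  proof (rule image_subsetI)
    fix v assume "v \<in> V"
    then show "t v \<in> {\<theta> 0..<\<theta> 0 + 2 * pi}"
      using idx[of v] t[of v] arc_division_mono[OF arc, of 0 "idx v"]
        arc_division_mono[OF arc, of "Suc (idx v)" p] arc by (auto simp: arc_division_def)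
  qed
  then have "inj_on (cis \<circ> t) V"
    using inj cis_inj_on_window[of "\<theta> 0"] by (intro comp_inj_on) (auto intro: inj_on_subset)
  moreover have "(cis \<circ> t) ` P i \<subseteq> arc_segment \<theta> i" if "i < p" for i
  proof (rule image_subsetI)
    fix v assume v: "v \<in> P i"
    then have "v \<in> V" using V \<open>i < p\<close> by blast
    then show "(cis \<circ> t) v \<in> arc_segment \<theta> i"
      using t[of v] unique[OF \<open>i < p\<close> v] by (simp add: arc_segment_def)
  qed
  moreover have "card {e \<in> E. x \<in> chord (cis \<circ> t) e} \<le> 2" if "x \<in> crossing_points E (cis \<circ> t)" for x
  proof -
    have "card {e \<in> E. x \<in> chord (cis \<circ> t) e} \<le> card {e \<in> pairs_of V. x \<in> chord (cis \<circ> t) e}"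
      using E finite_pairs_of[OF fin] by (intro card_mono) auto
    also have "\<dots> \<le> 2" using that by (intro generic) (simp add: crossing_points_def)
    finally show ?thesis .
  qed
  ultimately have "circular_drawing p V E P \<theta> (cis \<circ> t)"
    using P arc by (simp add: circular_drawing_def)
  then show ?thesis by (rule exI[of _ "cis \<circ> t"])
qed

section \<open>Drawings obtained from vertex labels\<close>

lemma arc_division_uniform: "p > 0 \<Longrightarrow> arc_division p (\<lambda>i. 2 * pi * real i / real p)"
  by (simp add: arc_division_def divide_strict_right_mono)

lemma K_numbered_partition:
  assumes "idx ` K_verts m n = {..<p}" "\<And>i j. i < m \<Longrightarrow> j < n \<Longrightarrow> idx (Inl i) \<noteq> idx (Inr j)"
  shows "numbered_partition p (K_verts m n) (K_edges m n) (\<lambda>l. {v \<in> K_verts m n. idx v = l})"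
proof -
  have "independent_set (K_edges m n) {v \<in> K_verts m n. idx v = l}" for l
    using assms(2) unfolding independent_set_def K_edges_def by (fastforce simp: doubleton_eq_iff)
  moreover have "{v \<in> K_verts m n. idx v = l} \<noteq> {}" if "l < p" for l
  proof -
    have "l \<in> idx ` K_verts m n" using assms(1) that by simp
    then show ?thesis by blast
  qed
  moreover have "(\<Union>l<p. {v \<in> K_verts m n. idx v = l}) = K_verts m n" using assms(1) by blast
  ultimately show ?thesis by (auto simp: numbered_partition_def disjoint_family_on_def)
qed

text \<open>Without a drawing the infimum in \<open>cpr\<close> would run over the empty set and
  default to 0. The first \<open>a\<close> parts take the left vertices and the others the right
  ones; \<open>min\<close> sends the surplus to the last part of each side.\<close>

lemma K_drawing_exists:
  assumes "m > 0" "n > 0" "k > 0" "2 * k \<le> m + n"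
  shows "\<exists>P \<theta> pos. circular_drawing (2 * k) (K_verts m n) (K_edges m n) P \<theta> pos"
proof -
  \<comment> \<open>As many left parts as possible while one part remains for the right vertices;
    there are then enough right vertices for the remaining \<open>2 * k - a\<close> parts.\<close>
  define a where "a = min m (2 * k - 1)"
  have a: "0 < a" "a \<le> m" "a < 2 * k" "2 * k \<le> a + n"
    using assms by (auto simp: a_def)
  define idx :: "nat + nat \<Rightarrow> nat"
    where "idx = case_sum (\<lambda>i. min i (a - 1)) (\<lambda>j. a + min j (2 * k - a - 1))"
  have "idx ` K_verts m n = {..<2 * k}"
  proof (intro equalityI subsetI)
    fix l assume l: "l \<in> idx ` K_verts m n"
    then show "l \<in> {..<2 * k}" using a by (auto simp: K_verts_def idx_def)
  next
    fix l assume l: "l \<in> {..<2 * k}"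
    show "l \<in> idx ` K_verts m n"
    proof (cases "l < a")
      case True
      then have "l = idx (Inl l)" "Inl l \<in> K_verts m n" using a by (auto simp: idx_def K_verts_def)
      then show ?thesis by blast
    next
      case False
      then have "l = idx (Inr (l - a))" "Inr (l - a) \<in> K_verts m n"
        using a l by (auto simp: idx_def K_verts_def)
      then show ?thesis by blast
    qed
  qed
  moreover have "idx (Inl i) \<noteq> idx (Inr j)" for i j using a by (simp add: idx_def)
  ultimately have "numbered_partition (2 * k) (K_verts m n) (K_edges m n) (\<lambda>l. {v \<in> K_verts m n. idx v = l})"
    by (intro K_numbered_partition)
  from circular_drawing_exists[OF finite_K_verts K_edges_subset this arc_division_uniform]
  show ?thesis using \<open>k > 0\<close> by simp blast
qed

section \<open>The balanced drawing\<close>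

lemma sum_lessThan_add:
  fixes f :: "nat \<Rightarrow> real"
  shows "sum f {..<a + b} = sum f {..<a} + (\<Sum>i<b. f (a + i))"
  by (induction b) (simp_all add: add.assoc)

lemma sum_mod:
  fixes h :: "nat \<Rightarrow> real"
  shows "(\<Sum>x<k * q. h (x mod k)) = real q * (\<Sum>x<k. h x)"
proof (induction q)
  case (Suc q)
  have "(\<Sum>x<k * Suc q. h (x mod k)) = (\<Sum>x<k * q + k. h (x mod k))" by (simp add: add.commute)
  also have "\<dots> = real (Suc q) * (\<Sum>x<k. h x)"
    unfolding sum_lessThan_add Suc by (simp add: algebra_simps)
  finally show ?case .
qed simp

lemma sum_mod_mod:
  fixes g :: "nat \<Rightarrow> nat \<Rightarrow> real"
  shows "(\<Sum>x<k * q. \<Sum>y<k * q. g (x mod k) (y mod k)) = real q ^ 2 * (\<Sum>x<k. \<Sum>y<k. g x y)"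
  unfolding sum_mod[where h = "g _"] sum_mod[where h = "\<lambda>x. real q * (\<Sum>y<k. g x y)"]
  by (simp add: sum_distrib_left power2_eq_square mult.assoc)

text \<open>This feeds the induction step of \<open>sum_distances\<close> at \<open>c = K\<close>;
  keeping \<open>c\<close> separate from \<open>K\<close> lets the closed form itself be proved by
  induction.\<close>

lemma sum_shifted_distance:
  fixes c k :: real
  shows "(\<Sum>x<K. (c - real x) * (k - (c - real x)))
           = real K * (c * k - c ^ 2) + (2 * c - k) * (real K * (real K - 1) / 2)
             - (real K - 1) * real K * (2 * real K - 1) / 6"
  by (induction K) (simp_all add: power2_eq_square field_simps)

text \<open>The constant \<open>k\<close> stays apart from the bound \<open>K\<close> so that
  induction applies. It is used at \<open>K = k\<close>, where the value is
  \<open>k ^ 2 * (k ^ 2 - 1) / 6\<close>.\<close>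

lemma sum_distances:
  fixes k :: real
  shows "(\<Sum>x<K. \<Sum>y<K. \<bar>real x - real y\<bar> * (k - \<bar>real x - real y\<bar>))
           = k * real K * (real K ^ 2 - 1) / 3 - real K ^ 2 * (real K ^ 2 - 1) / 6"
proof (induction K)
  case (Suc K)
  let ?g = "\<lambda>x y. \<bar>real x - real y\<bar> * (k - \<bar>real x - real y\<bar>)"
  have "(\<Sum>x<Suc K. \<Sum>y<Suc K. ?g x y)
      = (\<Sum>x<K. \<Sum>y<K. ?g x y) + (\<Sum>x<K. ?g x K) + (\<Sum>y<K. ?g K y)"
    by (simp add: sum.distrib)
  also have "(\<Sum>x<K. ?g x K) = (\<Sum>x<K. (real K - real x) * (k - (real K - real x)))"
    by (intro sum.cong) auto
  also have "(\<Sum>y<K. ?g K y) = (\<Sum>x<K. (real K - real x) * (k - (real K - real x)))"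
    by (intro sum.cong) auto
  finally show ?case
    unfolding Suc sum_shifted_distance by (simp add: power2_eq_square field_simps)
qed simp

text \<open>Residues modulo \<open>k\<close> split each side into \<open>k\<close> equal classes, of
  size \<open>q\<close> on the left and \<open>r\<close> on the right, and left and right classes
  alternate around the circle. This attains equality in the estimates of the lower bound.\<close>

lemma K_balanced_drawing:
  assumes "k > 0" "q > 0" "r > 0"
  defines "m \<equiv> k * q" and "n \<equiv> k * r"
  shows "\<exists>P \<theta> pos. circular_drawing (2 * k) (K_verts m n) (K_edges m n) P \<theta> pos \<and>
           real (card (crossing_points (K_edges m n) pos))
             = real (m choose 2) * real (n choose 2) - real m ^ 2 * real n ^ 2 * (1 - 1 / real k ^ 2) / 12"
proof -
  define idx :: "nat + nat \<Rightarrow> nat"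
    where "idx = case_sum (\<lambda>i. 2 * (i mod k)) (\<lambda>j. Suc (2 * (j mod k)))"
  define P where "P = (\<lambda>l. {v \<in> K_verts m n. idx v = l})"
  define \<theta> where "\<theta> = (\<lambda>i. 2 * pi * real i / real (2 * k))"
  have km: "k \<le> m" and kn: "k \<le> n" using assms by auto
  have "idx ` K_verts m n = {..<2 * k}"
  proof (intro equalityI subsetI)
    fix l assume "l \<in> idx ` K_verts m n"
    then obtain v where "l = idx v" by auto
    moreover have "i mod k < k" for i using \<open>k > 0\<close> by simp
    then have "2 * (i mod k) < 2 * k" "Suc (2 * (i mod k)) < 2 * k" for i
      using Suc_double_not_eq_double by (simp_all add: Suc_lessI)
    ultimately show "l \<in> {..<2 * k}" by (cases v) (auto simp: idx_def)
  next
    fix l assume "l \<in> {..<2 * k}"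
    then have half: "l div 2 < k" by auto
    show "l \<in> idx ` K_verts m n"
    proof (cases "even l")
      case True
      then have "l = idx (Inl (l div 2))" using half by (simp add: idx_def)
      moreover have "Inl (l div 2) \<in> K_verts m n" using half km by (auto simp: K_verts_def)
      ultimately show ?thesis by blast
    next
      case False
      then have "l = idx (Inr (l div 2))" using half by (simp add: idx_def)
      moreover have "Inr (l div 2) \<in> K_verts m n" using half kn by (auto simp: K_verts_def)
      ultimately show ?thesis by blast
    qed
  qed
  moreover have "idx (Inl i) \<noteq> idx (Inr j)" for i j
    using double_not_eq_Suc_double by (simp add: idx_def)
  ultimately have "numbered_partition (2 * k) (K_verts m n) (K_edges m n) P"
    unfolding P_def by (intro K_numbered_partition)
  moreover have arc: "arc_division (2 * k) \<theta>"
    unfolding \<theta>_def using \<open>k > 0\<close> by (intro arc_division_uniform) simp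
  ultimately obtain pos where draw: "circular_drawing (2 * k) (K_verts m n) (K_edges m n) P \<theta> pos"
    using circular_drawing_exists[OF finite_K_verts K_edges_subset] by blast
  obtain t where ang: "angles_on (K_verts m n) (\<theta> 0) t pos"
    and t: "\<And>i v. i < 2 * k \<Longrightarrow> v \<in> P i \<Longrightarrow> \<theta> i \<le> t v \<and> t v < \<theta> (Suc i)"
    using drawing_angles[OF draw] by blast
  have part: "\<theta> (idx v) \<le> t v" "t v < \<theta> (Suc (idx v))" "idx v < 2 * k" if "v \<in> K_verts m n" for v
  proof -
    show "idx v < 2 * k" using \<open>idx ` K_verts m n = {..<2 * k}\<close> that by blast
    then show "\<theta> (idx v) \<le> t v" "t v < \<theta> (Suc (idx v))" using t[of "idx v" v] that by (simp_all add: P_def)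
  qed
  have less: "t u < t v" if "u \<in> K_verts m n" "v \<in> K_verts m n" "idx u < idx v" for u v
    using part[OF that(1)] part[OF that(2)] arc_division_mono[OF arc, of "Suc (idx u)" "idx v"] that(3)
    by simp
  have order: "t (Inl i) < t (Inr j) \<longleftrightarrow> i mod k \<le> j mod k" if "i < m" "j < n" for i j
  proof -
    have V: "Inl i \<in> K_verts m n" "Inr j \<in> K_verts m n" using that by (auto simp: K_verts_def)
    show ?thesis
    proof (cases "i mod k \<le> j mod k")
      case True
      then show ?thesis using less[OF V] by (simp add: idx_def)
    next
      case False
      then show ?thesis using less[OF V(2,1)] by (simp add: idx_def)
    qed
  qed
  let ?F = "\<lambda>j. real (card {i \<in> {..<m}. (t \<circ> Inl) i < (t \<circ> Inr) j})"
  \<comment> \<open>The left parts before the right part of residue \<open>j mod k\<close> are those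
    of residues 0 up to \<open>j mod k\<close>, each with \<open>q\<close> vertices; hence the
    \<open>Suc\<close>, which cancels in differences.\<close>
  have F: "?F j = real q * real (Suc (j mod k))" if "j < n" for j
  proof -
    have "?F j = real (card {i \<in> {..<m}. i mod k \<le> j mod k})"
      using order[OF _ that] by (intro arg_cong[of _ _ real] arg_cong[of _ _ card]) auto
    also have "\<dots> = (\<Sum>i<m. of_bool (i mod k \<le> j mod k))" by (simp add: Int_def)
    also have "\<dots> = real q * (\<Sum>i<k. of_bool (i \<le> j mod k))"
      unfolding m_def by (rule sum_mod)
    also have "(\<Sum>i<k. of_bool (i \<le> j mod k)) = real (card {i \<in> {..<k}. i \<le> j mod k})"
      by (simp add: Int_def)
    also have "{i \<in> {..<k}. i \<le> j mod k} = {..j mod k}"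
      using mod_less_divisor[OF \<open>k > 0\<close>, of j] by auto
    finally show ?thesis by simp
  qed
  let ?g = "\<lambda>x y. \<bar>real x - real y\<bar> * (real k - \<bar>real x - real y\<bar>)"
  have energy: "\<bar>?F j - ?F j'\<bar> * (real m - \<bar>?F j - ?F j'\<bar>) = real q ^ 2 * ?g (j mod k) (j' mod k)"
    if "j < n" "j' < n" for j j'
  proof -
    have "?F j - ?F j' = real q * (real (j mod k) - real (j' mod k))"
      unfolding F[OF that(1)] F[OF that(2)] by (simp add: algebra_simps)
    then have "\<bar>?F j - ?F j'\<bar> = real q * \<bar>real (j mod k) - real (j' mod k)\<bar>"
      by (simp add: abs_mult)
    then show ?thesis by (simp add: m_def power2_eq_square algebra_simps)
  qed
  have disj: "(t \<circ> Inl) ` {..<m} \<inter> (t \<circ> Inr) ` {..<n} = {}"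
    using ang by (auto simp: angles_on_def inj_on_def K_verts_def)
  have "alternations {..<m} {..<n} (t \<circ> Inl) (t \<circ> Inr)
      = 2 * (\<Sum>j<n. \<Sum>j'<n. \<bar>?F j - ?F j'\<bar> * (real m - \<bar>?F j - ?F j'\<bar>))"
    using alternations_eq[OF _ _ disj] by simp
  also have "(\<Sum>j<n. \<Sum>j'<n. \<bar>?F j - ?F j'\<bar> * (real m - \<bar>?F j - ?F j'\<bar>))
      = (\<Sum>j<n. \<Sum>j'<n. real q ^ 2 * ?g (j mod k) (j' mod k))"
    by (intro sum.cong refl energy) auto
  also have "\<dots> = real q ^ 2 * (\<Sum>j<n. \<Sum>j'<n. ?g (j mod k) (j' mod k))"
    by (simp only: sum_distrib_left)
  also have "(\<Sum>j<n. \<Sum>j'<n. ?g (j mod k) (j' mod k)) = real r ^ 2 * (\<Sum>x<k. \<Sum>y<k. ?g x y)"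
    unfolding n_def by (rule sum_mod_mod)
  also have "2 * (real q ^ 2 * (real r ^ 2 * (\<Sum>x<k. \<Sum>y<k. ?g x y)))
      = real m ^ 2 * real n ^ 2 * (1 - 1 / real k ^ 2) / 3"
    unfolding sum_distances using \<open>k > 0\<close>
    by (simp add: m_def n_def power2_eq_square field_simps)
  finally have "alternations {..<m} {..<n} (t \<circ> Inl) (t \<circ> Inr)
      = real m ^ 2 * real n ^ 2 * (1 - 1 / real k ^ 2) / 3" .
  moreover have "\<forall>x\<in>crossing_points (K_edges m n) pos. card {e \<in> K_edges m n. x \<in> chord pos e} \<le> 2"
    using draw by (simp add: circular_drawing_def)
  ultimately have "real (card (crossing_points (K_edges m n) pos))
      = real (m choose 2) * real (n choose 2) - real m ^ 2 * real n ^ 2 * (1 - 1 / real k ^ 2) / 12"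
    using card_K_crossing_points[OF ang] by simp
  then show ?thesis using draw by blast
qed

section \<open>The minimum compared with both bounds\<close>

theorem theorem2:
  fixes m n k :: nat
  assumes "m > 0" and "n > 0" and "k > 0" and "2 * k \<le> m + n"
  shows "real (cpr (2 * k) (K_verts m n) (K_edges m n)) \<ge>
           real (m choose 2) * real (n choose 2)
             - (real k ^ 4 - real k ^ 2) * real m ^ 2 * real n ^ 2 / (12 * real k ^ 4)
       \<and> (k dvd m \<and> k dvd n \<longrightarrow>
           real (cpr (2 * k) (K_verts m n) (K_edges m n)) =
             real (m choose 2) * real (n choose 2)
               - (real k ^ 4 - real k ^ 2) * real m ^ 2 * real n ^ 2 / (12 * real k ^ 4))"
proof -
  let ?S = "{card (crossing_points (K_edges m n) pos) |P \<theta> pos.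
      circular_drawing (2 * k) (K_verts m n) (K_edges m n) P \<theta> pos}"
  define b where "b = real (m choose 2) * real (n choose 2)
    - real m ^ 2 * real n ^ 2 * (1 - 1 / real k ^ 2) / 12"
  have bound: "real (m choose 2) * real (n choose 2)
      - (real k ^ 4 - real k ^ 2) * real m ^ 2 * real n ^ 2 / (12 * real k ^ 4) = b"
    using \<open>k > 0\<close> by (simp add: b_def power2_eq_square power4_eq_xxxx field_simps)
  have cpr: "cpr (2 * k) (K_verts m n) (K_edges m n) = Inf ?S"
    by (simp add: cpr_def)
  have "?S \<noteq> {}" using K_drawing_exists[OF assms] by blast
  \<comment> \<open>The infimum is attained, so it is the crossing count of an actual drawing, to
    which the lower bound applies.\<close>
  then have "Inf ?S \<in> ?S" by (rule Inf_nat_def1)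
  then obtain P \<theta> pos where eq: "Inf ?S = card (crossing_points (K_edges m n) pos)"
    and draw: "circular_drawing (2 * k) (K_verts m n) (K_edges m n) P \<theta> pos" by blast
  have lower: "b \<le> real (Inf ?S)"
    unfolding eq b_def by (rule K_drawing_crossings_ge[OF draw \<open>k > 0\<close>])
  have "real (Inf ?S) \<le> b" if dvd: "k dvd m" "k dvd n"
  proof -
    obtain q r where qr: "m = k * q" "n = k * r" using dvd by (meson dvdE)
    then have "q > 0" "r > 0" using assms by auto
    from K_balanced_drawing[OF \<open>k > 0\<close> this]
    obtain P \<theta> pos where "circular_drawing (2 * k) (K_verts m n) (K_edges m n) P \<theta> pos"
      and eq: "real (card (crossing_points (K_edges m n) pos)) = b"
      unfolding qr[symmetric] b_def by blast
    then have "card (crossing_points (K_edges m n) pos) \<in> ?S" by blast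
    then have "Inf ?S \<le> card (crossing_points (K_edges m n) pos)" by (rule wellorder_Inf_le1)
    then show ?thesis using eq by linarith
  qed
  with lower show ?thesis unfolding bound cpr by (intro conjI impI antisym) simp_all
qed

end
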